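(* Let $T$ be a tree with at least three vertices. Then $\varphi(T)$ equals the number of vertices in the skeleton of $T$. Furthermore, there is a linear-time algorithm that, given such a tree $T$, produces an optimal overlap representation of $T$ (that is, one of size $\varphi(T)$).
   Context: Graphs are finite and simple. Two sets overlap if they intersect but neither contains the other. An overlap representation of a graph $G$ is an assignment $f$ of sets to the vertices of $G$ such that, for distinct vertices $u,v$, $uv\in E(G)$ if and only if $f(u)$ and $f(v)$ overlap. When the assigned sets are finite, the size of $f$ is $\left|\bigcup_{v\in V(G)} f(v)\right|$. The overlap number $\varphi(G)$ is the minimum size of an overlap representation of $G$ by finite sets. A leaf is a vertex of degree 1. A skeleton is a tree in which the neighbor of any leaf has degree 2. The skeleton of a tree $T$ is the largest subtree of $T$ that is a skeleton; it is unique up to isomorphism. *)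

theory Defs
  imports "Graph_Theory.Graph_Theory"
begin

section \<open>Graphs, trees, skeletons\<close>

text \<open>
  A finite simple graph is a \<open>pair_graph\<close>: every edge \<open>uv\<close> is present as the two arcs \<open>(u,v)\<close>
  and \<open>(v,u)\<close>.  The predicates \<open>forest\<close> and \<open>tree\<close> of Graph\_Theory are not usable for
  undirected trees, since there the closed walk \<open>u, v, u\<close> along one edge counts as a cycle.
  In a simple graph the cycles in the usual sense are the library's cycles of length at least 3.
\<close>

definition undirected_tree :: "'a pair_pre_digraph \<Rightarrow> bool" where
  "undirected_tree T \<longleftrightarrow>
     pair_graph T \<and> connected (with_proj T) \<and>
     \<not> (\<exists>p. pre_digraph.cycle (with_proj T) p \<and> 3 \<le> length p)"

definition degree :: "'a pair_pre_digraph \<Rightarrow> 'a \<Rightarrow> nat" where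
  "degree G v = out_degree (with_proj G) v"

definition leaf :: "'a pair_pre_digraph \<Rightarrow> 'a \<Rightarrow> bool" where
  "leaf G v \<longleftrightarrow> v \<in> pverts G \<and> degree G v = 1"

definition skeleton :: "'a pair_pre_digraph \<Rightarrow> bool" where
  "skeleton S \<longleftrightarrow>
     undirected_tree S \<and> (\<forall>v u. leaf S v \<and> (v, u) \<in> parcs S \<longrightarrow> degree S u = 2)"

text \<open>\<open>S\<close> is a largest subtree of \<open>T\<close> that is a skeleton; it is unique only up to isomorphism.\<close>

definition skeleton_of :: "'a pair_pre_digraph \<Rightarrow> 'a pair_pre_digraph \<Rightarrow> bool" where
  "skeleton_of S T \<longleftrightarrow>
     skeleton S \<and> subgraph (with_proj S) (with_proj T) \<and>
     (\<forall>S'. skeleton S' \<and> subgraph (with_proj S') (with_proj T)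
        \<longrightarrow> card (pverts S') \<le> card (pverts S))"

section \<open>Overlap representations\<close>

definition overlap :: "'b set \<Rightarrow> 'b set \<Rightarrow> bool" where
  "overlap A B \<longleftrightarrow> A \<inter> B \<noteq> {} \<and> \<not> A \<subseteq> B \<and> \<not> B \<subseteq> A"

definition overlap_rep :: "'a pair_pre_digraph \<Rightarrow> ('a \<Rightarrow> 'b set) \<Rightarrow> bool" where
  "overlap_rep G f \<longleftrightarrow>
     (\<forall>u \<in> pverts G. \<forall>v \<in> pverts G. u \<noteq> v \<longrightarrow>
        ((u, v) \<in> parcs G \<longleftrightarrow> overlap (f u) (f v)))"

definition finite_overlap_rep :: "'a pair_pre_digraph \<Rightarrow> ('a \<Rightarrow> 'b set) \<Rightarrow> bool" where
  "finite_overlap_rep G f \<longleftrightarrow> overlap_rep G f \<and> (\<forall>v \<in> pverts G. finite (f v))"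

definition rep_size :: "'a pair_pre_digraph \<Rightarrow> ('a \<Rightarrow> 'b set) \<Rightarrow> nat" where
  "rep_size G f = card (\<Union>v \<in> pverts G. f v)"

text \<open>
  Elements may be taken to be natural numbers, since only finitely many of them are used.
\<close>

definition overlap_number :: "'a pair_pre_digraph \<Rightarrow> nat" where
  "overlap_number G =
     (LEAST k. \<exists>f :: 'a \<Rightarrow> nat set. finite_overlap_rep G f \<and> rep_size G f = k)"

definition optimal_overlap_rep :: "'a pair_pre_digraph \<Rightarrow> ('a \<Rightarrow> nat set) \<Rightarrow> bool" where
  "optimal_overlap_rep G f \<longleftrightarrow> finite_overlap_rep G f \<and> rep_size G f = overlap_number G"

section \<open>A random access machine with unit costs\<close>

text \<open>
  The memory consists of arrays \<open>0, 1, 2, \<dots>\<close> of natural numbers; array names are constants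
  of the program, so a program uses finitely many of them.  Indirect addressing is array access.
  The only arithmetic is increment and decrement by 1, so in \<open>t\<close> steps the stored numbers grow by
  \<open>O(t)\<close> only: a linear-time computation handles numbers of \<open>O(log n)\<close> bits, and the unit-cost
  assumption cannot be exploited by building huge numbers.
\<close>

type_synonym memory = "nat \<Rightarrow> nat \<Rightarrow> nat"

datatype aexp = Const nat | Read nat aexp | Inc aexp | Dec aexp

datatype bexp = Less aexp aexp | Equal aexp aexp | Neg bexp | Conj bexp bexp

datatype com =
    Skip
  | Write nat aexp aexp
  | Seq com com
  | Cond bexp com com
  | While bexp com

primrec aval :: "aexp \<Rightarrow> memory \<Rightarrow> nat" where
  "aval (Const k) s = k"
| "aval (Read a e) s = s a (aval e s)"
| "aval (Inc e) s = aval e s + 1"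
| "aval (Dec e) s = aval e s - 1"

primrec bval :: "bexp \<Rightarrow> memory \<Rightarrow> bool" where
  "bval (Less e e') s \<longleftrightarrow> aval e s < aval e' s"
| "bval (Equal e e') s \<longleftrightarrow> aval e s = aval e' s"
| "bval (Neg b) s \<longleftrightarrow> \<not> bval b s"
| "bval (Conj b b') s \<longleftrightarrow> bval b s \<and> bval b' s"

text \<open>
  \<open>exec c s t s'\<close>: started in memory \<open>s\<close>, the program \<open>c\<close> halts after \<open>t\<close> steps in memory \<open>s'\<close>.
  Each assignment and each test is one step; the expressions occurring in a fixed program have
  bounded size, so charging for their subexpressions would only change the constant.
\<close>

inductive exec :: "com \<Rightarrow> memory \<Rightarrow> nat \<Rightarrow> memory \<Rightarrow> bool" where
  skip: "exec Skip s 1 s"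
| wr: "exec (Write a i e) s 1 (s(a := (s a)(aval i s := aval e s)))"
| seq: "exec c s t s' \<Longrightarrow> exec d s' t' s'' \<Longrightarrow> exec (Seq c d) s (t + t') s''"
| cond_true: "bval b s \<Longrightarrow> exec c s t s' \<Longrightarrow> exec (Cond b c d) s (Suc t) s'"
| cond_false: "\<not> bval b s \<Longrightarrow> exec d s t s' \<Longrightarrow> exec (Cond b c d) s (Suc t) s'"
| while_true: "bval b s \<Longrightarrow> exec c s t s' \<Longrightarrow> exec (While b c) s' t' s''
    \<Longrightarrow> exec (While b c) s (Suc (t + t')) s''"
| while_false: "\<not> bval b s \<Longrightarrow> exec (While b c) s 1 s"

inductive_cases exec_elims:
  "exec Skip s t s'" "exec (Write a i e) s t s'" "exec (Seq c d) s t s'"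
  "exec (Cond b c d) s t s'"
inductive_cases exec_while_elim: "exec (While b c) s t s'"

lemma exec_deterministic:
  "exec c s t s' \<Longrightarrow> exec c s u s'' \<Longrightarrow> u = t \<and> s'' = s'"
proof (induction arbitrary: u s'' rule: exec.induct)
  case (while_true b s c t s' t' s1)
  from while_true.prems show ?case
    by (rule exec_while_elim) (use while_true in blast)+
next
  case (while_false b s c)
  from while_false.prems show ?case
    by (rule exec_while_elim) (use while_false in auto)
qed (erule exec_elims; force)+

section \<open>Input and output of algorithms\<close>

text \<open>A graph with vertices \<open>0, \<dots>, n - 1\<close> is given by \<open>n\<close> and a list of its edges, each edge
  listed once, in arbitrary order and with its ends in arbitrary order.\<close>

definition edge_list :: "nat pair_pre_digraph \<Rightarrow> (nat \<times> nat) list \<Rightarrow> bool" where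
  "edge_list G es \<longleftrightarrow>
     distinct es \<and> set es \<inter> (set es)\<inverse> = {} \<and> parcs G = set es \<union> (set es)\<inverse>"

definition input_memory :: "nat \<Rightarrow> (nat \<times> nat) list \<Rightarrow> memory" where
  "input_memory n es a i =
     (if a = 0 \<and> i = 0 then n
      else if a = 1 \<and> i < length es then fst (es ! i)
      else if a = 2 \<and> i < length es then snd (es ! i)
      else 0)"

text \<open>
  An assignment of finite sets of natural numbers is output in run-length encoding: a list of
  \<open>m\<close> triples \<open>(v, l, r)\<close>, each telling that \<open>{l..r}\<close> is part of the set of \<open>v\<close>.
  Every assignment of finite sets can be so written.  Element-by-element output is ruled out for
  linear-time algorithms: in every optimal representation of the subdivision of a star with
  \<open>k\<close> edges, the cardinalities of the sets add up to order \<open>k\<^sup>2\<close>.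
\<close>

definition output_sets :: "memory \<Rightarrow> nat \<Rightarrow> nat set" where
  "output_sets s v = (\<Union>j \<in> {j. j < s 3 0 \<and> s 4 j = v}. {s 5 j..s 6 j})"

end

theory Submission
  imports Defs
begin

text \<open>
  Call a vertex of the tree \<open>T\<close> inner if it is not a leaf.  The inner vertices form a subtree
  \<open>I\<close>.  Adding to \<open>I\<close> one leaf of \<open>T\<close> at each end of \<open>I\<close> (two leaves if \<open>I\<close> is a single vertex)
  gives a skeleton \<open>S\<close>.  Three facts settle the first part of the theorem: \<open>T\<close> has an overlap
  representation of size at most \<open>|S|\<close>; the representation restricts to every subtree, so it is enough
  that a skeleton with \<open>m \<ge> 3\<close> vertices needs \<open>m\<close> elements; and then
  \<open>|S'| \<le> \<phi>(T) \<le> |S|\<close> for every skeleton \<open>S'\<close> in \<open>T\<close>, so \<open>S\<close> is a largest one and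
  \<open>\<phi>(T) = |S|\<close>.

  Upper bound.  Root \<open>I\<close> at one of its ends \<open>r\<close> and number its vertices in preorder from 1 on, giving
  an extra number to each childless vertex.  An inner vertex \<open>v\<close> with parent \<open>p\<close> gets the
  interval from the number of \<open>p\<close> to the number of \<open>v\<close> (from 0 if \<open>v = r\<close>), and a leaf attached to \<open>v\<close>
  gets the interval from the number of \<open>v\<close> to the last number given out below \<open>v\<close>.  The ranges of the
  numbers below the various vertices are laminar, and this makes exactly the adjacent pairs overlap (\<open>interval_rep_correct\<close>).  The
  numbers are \<open>0\<close>, one for each inner vertex and one for each childless inner vertex, which is the
  size of \<open>S\<close> (\<open>skeletal_subtree_exists\<close>).

  Lower bound.  Add one point outside of all sets.  Two sets overlap if and only if the partitions
  of the enlarged ground set into set and complement cross, that is, all four cells are nonempty.  This is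
  symmetric under complementation.  The claim becomes that a family of partitions whose crossing
  graph is a skeleton with \<open>m \<ge> 3\<close> vertices lives on at least \<open>m + 1\<close> points
  (\<open>cross_tree_lower_bound\<close>).  The proof is by induction.  A skeleton has a leaf \<open>w\<close> whose neighbour
  \<open>u\<close> has one further neighbour \<open>x\<close>.  All other vertices are constant on the same side of \<open>w\<close>, so
  that on this side only \<open>u\<close> separates points, and one of two points there can be deleted
  together with \<open>w\<close> (\<open>prune_leaf\<close>).  If \<open>x\<close> has degree 2, what remains is a skeleton.  Otherwise \<open>u\<close>
  has to go as well.  If \<open>u\<close> was chosen to have the smallest side among all such vertices, then
  all remaining vertices other than \<open>x\<close> are constant on this side (\<open>smallest_side_const\<close>), and
  \<open>prune_leaf\<close> applies once more with \<open>u\<close> as the leaf.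

  Algorithm.  Each vertex has a single interval as its set, so the output has linear size.  The program
  builds linked adjacency lists, looks for an end of \<open>I\<close>, and computes the numbering by a depth-first
  search.  The invariant of the search (\<open>dfs_state\<close>) does not mention the program; it yields the
  numbering for trees over arbitrary vertices too.
\<close>

section \<open>Trees given by their vertices and arcs\<close>

text \<open>
  Connectedness and absence of cycles are stated in the forms that the arguments below consume: a set
  closed under adjacency is everything, and no set of vertices induces too many arcs.  (Each edge is
  two arcs.)  The second condition is inherited by induced subgraphs, and it yields vertices of degree at
  most 1 by counting instead of by following paths.
\<close>

locale arc_tree =
  fixes V :: "'a set" and E :: "('a \<times> 'a) set"
  assumes finite_verts: "finite V"
    and arcs_in: "E \<subseteq> V \<times> V"
    and arcs_sym: "(u, v) \<in> E \<Longrightarrow> (v, u) \<in> E"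
    and arcs_irrefl: "(u, u) \<notin> E"
    and closed_eq: "D \<subseteq> V \<Longrightarrow> D \<noteq> {} \<Longrightarrow> (\<And>u v. u \<in> D \<Longrightarrow> (u, v) \<in> E \<Longrightarrow> v \<in> D) \<Longrightarrow> D = V"
    and sparse: "Z \<subseteq> V \<Longrightarrow> Z \<noteq> {} \<Longrightarrow> card (E \<inter> Z \<times> Z) + 2 \<le> 2 * card Z"
begin

lemma finite_arcs: "finite E"
  using arcs_in finite_verts finite_subset by blast

lemma finite_nbrs: "finite (E `` {v})"
  using arcs_in finite_verts by (meson Image_singleton_iff SigmaD2 finite_subset subsetD subsetI)

lemma arcD: "(u, v) \<in> E \<Longrightarrow> u \<in> V" "(u, v) \<in> E \<Longrightarrow> v \<in> V" "(u, v) \<in> E \<Longrightarrow> u \<noteq> v"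
  using arcs_in arcs_irrefl by auto

lemma arcs_within_eq_sum:
  assumes "finite Z"
  shows "card (E \<inter> Z \<times> Z) = (\<Sum>z\<in>Z. card (E `` {z} \<inter> Z))"
proof -
  have "E \<inter> Z \<times> Z = (SIGMA z:Z. E `` {z} \<inter> Z)" by auto
  then show ?thesis using card_SigmaI[of Z "\<lambda>z. E `` {z} \<inter> Z"] assms by simp
qed

lemma ex_low_degree:
  assumes "Z \<subseteq> V" "Z \<noteq> {}"
  shows "\<exists>z\<in>Z. card (E `` {z} \<inter> Z) \<le> 1"
proof (rule ccontr)
  assume "\<not> ?thesis"
  then have "(\<Sum>z\<in>Z. 2) \<le> (\<Sum>z\<in>Z. card (E `` {z} \<inter> Z))"
    by (intro sum_mono) force
  moreover have "finite Z" using assms finite_verts finite_subset by blast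
  ultimately show False using sparse[OF assms] arcs_within_eq_sum by simp
qed

lemma nbr_exists:
  assumes "v \<in> V" "2 \<le> card V"
  shows "E `` {v} \<noteq> {}"
proof
  assume "E `` {v} = {}"
  then have "{v} = V" using closed_eq[of "{v}"] assms by auto
  then show False using assms by auto
qed

lemma no_triangle:
  assumes "(x, y) \<in> E" "(y, z) \<in> E" "(x, z) \<in> E"
  shows False
proof -
  have d: "x \<noteq> y" "y \<noteq> z" "x \<noteq> z" and V: "{x, y, z} \<subseteq> V" using assms arcD by auto
  have "card {(x,y),(y,x),(y,z),(z,y),(x,z),(z,x)} \<le> card (E \<inter> {x,y,z} \<times> {x,y,z})"
    using assms arcs_sym finite_arcs by (intro card_mono) auto
  then show False using sparse[OF V] d by simp
qed

text \<open>
  Sparsity is inherited, so only connectedness remains to be checked for an induced subgraph.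
\<close>

lemma induced:
  assumes "A \<subseteq> V"
    and "\<And>D. D \<subseteq> A \<Longrightarrow> D \<noteq> {} \<Longrightarrow> (\<And>u v. u \<in> D \<Longrightarrow> v \<in> A \<Longrightarrow> (u, v) \<in> E \<Longrightarrow> v \<in> D) \<Longrightarrow> D = A"
  shows "arc_tree A (E \<inter> A \<times> A)"
proof
  show "finite A" using assms(1) finite_verts finite_subset by blast
  fix Z assume Z: "Z \<subseteq> A" "Z \<noteq> {}"
  then have "(E \<inter> A \<times> A) \<inter> Z \<times> Z = E \<inter> Z \<times> Z" by auto
  then show "card ((E \<inter> A \<times> A) \<inter> Z \<times> Z) + 2 \<le> 2 * card Z"
    using sparse[of Z] Z assms(1) by auto
next
  fix D assume "D \<subseteq> A" "D \<noteq> {}" "\<And>u v. u \<in> D \<Longrightarrow> (u, v) \<in> E \<inter> A \<times> A \<Longrightarrow> v \<in> D"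
  then show "D = A" by (intro assms(2)) auto
qed (use arcs_sym arcs_irrefl in auto)

lemma remove_leaf:
  assumes "w \<in> V" "E `` {w} \<subseteq> {u}"
  shows "arc_tree (V - {w}) (E \<inter> (V - {w}) \<times> (V - {w}))"
proof (rule induced)
  fix D assume D: "D \<subseteq> V - {w}" "D \<noteq> {}"
    and cl: "\<And>a b. a \<in> D \<Longrightarrow> b \<in> V - {w} \<Longrightarrow> (a, b) \<in> E \<Longrightarrow> b \<in> D"
  define D' where "D' = (if u \<in> D then insert w D else D)"
  have "D' = V"
  proof (rule closed_eq)
    show "D' \<subseteq> V" "D' \<noteq> {}" using D assms by (auto simp: D'_def split: if_splits)
    fix a b assume ab: "a \<in> D'" "(a, b) \<in> E"
    show "b \<in> D'"
    proof (cases "b = w")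
      case True
      then have "a = u" using ab assms(2) arcs_sym by blast
      then show ?thesis using ab True assms(2) arcD(3) arcs_sym by (auto simp: D'_def split: if_splits)
    next
      case False
      then show ?thesis using ab cl[of a b] arcD(2) assms(2) by (auto simp: D'_def split: if_splits)
    qed
  qed
  then show "D = V - {w}" using D assms(1) by (auto simp: D'_def split: if_splits)
qed auto

text \<open>
  A connected graph on \<open>n\<close> vertices has at least \<open>n - 1\<close> edges.  A largest set of vertices that satisfies the bound is
  closed under adjacency, as each arc that leaves it brings two arcs with the new vertex.
\<close>

lemma many_arcs:
  shows "2 * card V \<le> card E + 2"
proof (cases "V = {}")
  case False
  then obtain r where r: "r \<in> V" by blast
  define P where "P D \<longleftrightarrow> D \<subseteq> V \<and> D \<noteq> {} \<and> 2 * card D \<le> card (E \<inter> D \<times> D) + 2" for D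
  have fin: "finite {D. P D}" using finite_verts by (auto intro: finite_subset[of _ "Pow V"] simp: P_def)
  have "P {r}" using r by (auto simp: P_def)
  then obtain D where D: "P D" and max: "\<And>D'. P D' \<Longrightarrow> card D' \<le> card D"
    using fin Max_in[of "card ` {D. P D}"] Max_ge[of "card ` {D. P D}"] by fastforce
  have "D = V"
  proof (rule ccontr)
    assume "D \<noteq> V"
    then obtain a b where ab: "a \<in> D" "(a, b) \<in> E" "b \<notin> D"
      using closed_eq[of D] D by (auto simp: P_def)
    have fD: "finite D" using D finite_verts finite_subset by (auto simp: P_def)
    have "card (E \<inter> D \<times> D \<union> {(a,b),(b,a)}) \<le> card (E \<inter> insert b D \<times> insert b D)"
      using ab arcs_sym finite_arcs by (intro card_mono) auto
    moreover have "card (E \<inter> D \<times> D \<union> {(a,b),(b,a)}) = card (E \<inter> D \<times> D) + 2"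
    proof -
      have "a \<noteq> b" using ab by blast
      then show ?thesis using ab fD by (subst card_Un_disjoint) auto
    qed
    ultimately have "P (insert b D)" using D ab fD arcD(2)[OF ab(2)] by (auto simp: P_def)
    then show False using max[of "insert b D"] ab fD by auto
  qed
  then show ?thesis using D arcs_in by (auto simp: P_def Int_absorb2)
qed auto

end

text \<open>
  All neighbours of the first vertex of a longest path lie on this path, and one that is not its second
  vertex closes a cycle through at least three vertices.
\<close>

lemma many_nbrs_imp_cycle:
  assumes fin: "finite Z" "Z \<noteq> {}" and irr: "\<And>u. (u, u) \<notin> E"
    and two: "\<And>z. z \<in> Z \<Longrightarrow> 2 \<le> card (E `` {z} \<inter> Z)"
  shows "\<exists>vs. distinct vs \<and> 3 \<le> length vs \<and> set vs \<subseteq> Z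
    \<and> successively (\<lambda>a b. (a, b) \<in> E\<inverse>) vs \<and> (hd vs, last vs) \<in> E"
proof -
  define P where "P vs \<longleftrightarrow> distinct vs \<and> set vs \<subseteq> Z \<and> vs \<noteq> []
    \<and> successively (\<lambda>a b. (a, b) \<in> E\<inverse>) vs" for vs
  have bound: "length vs \<le> card Z" if "P vs" for vs
    using that fin by (metis P_def card_mono distinct_card)
  obtain z where "z \<in> Z" using fin by blast
  then have "P [z]" by (auto simp: P_def)
  then obtain vs where vs: "P vs" and max: "\<And>ws. P ws \<Longrightarrow> length ws \<le> length vs"
    using ex_has_greatest_nat[of P "[z]" length "Suc (card Z)"] bound by (auto simp: less_Suc_eq_le)
  then obtain a ws where a: "vs = a # ws" by (cases vs) (auto simp: P_def)
  have "\<exists>y \<in> E `` {a} \<inter> Z. ws = [] \<or> y \<noteq> hd ws"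
  proof (rule ccontr)
    assume "\<not> ?thesis"
    then have "E `` {a} \<inter> Z \<subseteq> {hd ws}" by auto
    then have "card (E `` {a} \<inter> Z) \<le> 1" by (metis card.empty card.insert card_mono empty_iff finite.emptyI finite.insertI One_nat_def)
    then show False using two[of a] vs a by (auto simp: P_def)
  qed
  then obtain y where y: "(a, y) \<in> E" "y \<in> Z" "ws = [] \<or> y \<noteq> hd ws" by auto
  have "y \<in> set vs"
  proof (rule ccontr)
    assume "y \<notin> set vs"
    then have "P (y # vs)" using vs y a by (auto simp: P_def)
    then show False using max by force
  qed
  then obtain i where i: "i < length vs" "vs ! i = y" by (auto simp: in_set_conv_nth)
  have "i \<noteq> 0" using i y irr a by (cases i) auto
  moreover have "i \<noteq> 1" using i y a by (cases ws) auto
  ultimately have i2: "2 \<le> i" by linarith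
  let ?c = "take (Suc i) vs"
  have "last ?c = y" using i by (simp add: take_Suc_conv_app_nth)
  moreover have "hd ?c = a" using a by simp
  moreover have "successively (\<lambda>a b. (a, b) \<in> E\<inverse>) ?c"
    using vs append_take_drop_id[of "Suc i" vs] successively_append_iff unfolding P_def by metis
  moreover have "set ?c \<subseteq> Z" using vs set_take_subset[of "Suc i" vs] by (auto simp: P_def)
  moreover have "distinct ?c" "3 \<le> length ?c" using vs i i2 by (auto simp: P_def)
  ultimately show ?thesis using y by (intro exI[of _ ?c]) auto
qed

lemma successively_imp_walk:
  assumes "successively (\<lambda>a b. (a, b) \<in> E) vs" "vs \<noteq> []"
  shows "\<exists>p. set p \<subseteq> E \<and> pcas (hd vs) p (last vs) \<and> pawalk_verts (hd vs) p = vs"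
  using assms
proof (induction vs)
  case (Cons a vs)
  show ?case
  proof (cases vs)
    case Nil
    then show ?thesis by (intro exI[of _ "[]"]) auto
  next
    case (Cons b ws)
    then obtain p where "set p \<subseteq> E" "pcas b p (last vs)" "pawalk_verts b p = vs"
      using Cons.IH Cons.prems by auto
    then show ?thesis using Cons.prems Cons by (intro exI[of _ "(a,b) # p"]) auto
  qed
qed auto

lemma pcas_snoc: "pcas u (p @ [e]) v \<longleftrightarrow> pcas u p (fst e) \<and> snd e = v"
  by (induction p arbitrary: u) auto

lemma pawalk_verts_snoc: "pcas u p (fst e) \<Longrightarrow> pawalk_verts u (p @ [e]) = pawalk_verts u p @ [snd e]"
  by (induction p arbitrary: u) auto

lemma length_pawalk_verts: "length (pawalk_verts u p) = Suc (length p)"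
  by (induction p arbitrary: u) auto

text \<open>
  Without cycles of length at least 3 every nonempty set \<open>Z\<close> of vertices contains a vertex with at
  most one neighbour in \<open>Z\<close>.  Removing such vertices one by one gives the bound on the arcs within \<open>Z\<close>.
\<close>

lemma undirected_tree_arc_tree:
  assumes "undirected_tree T"
  shows "arc_tree (pverts T) (parcs T)"
proof -
  interpret pair_graph T using assms by (simp add: undirected_tree_def)
  have nocyc: "\<not> (\<exists>p. cycle p \<and> 3 \<le> length p)" using assms by (simp add: undirected_tree_def)
  have sym: "(v, u) \<in> parcs T" if "(u, v) \<in> parcs T" for u v
    using that arcs_symmetric by auto
  have irr: "(u, u) \<notin> parcs T" for u using no_loops' by blast
  have low: "\<exists>z\<in>Z. card (parcs T `` {z} \<inter> Z) < 2" if "Z \<subseteq> pverts T" "Z \<noteq> {}" for Z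
  proof (rule ccontr)
    assume "\<not> ?thesis"
    moreover have "finite Z" using that pair_finite_verts finite_subset by blast
    ultimately obtain vs where vs: "distinct vs" "3 \<le> length vs" "set vs \<subseteq> Z"
        "successively (\<lambda>a b. (a, b) \<in> (parcs T)\<inverse>) vs" "(hd vs, last vs) \<in> parcs T"
      using many_nbrs_imp_cycle[of Z "parcs T"] \<open>Z \<noteq> {}\<close> no_loops' by force
    have "successively (\<lambda>a b. (a, b) \<in> parcs T) vs"
      using vs(4) by (rule successively_mono) (use sym in auto)
    then obtain p where p: "set p \<subseteq> parcs T" "pcas (hd vs) p (last vs)" "pawalk_verts (hd vs) p = vs"
      using successively_imp_walk[of "parcs T" vs] vs(2) by fastforce
    let ?p = "p @ [(last vs, hd vs)]"
    have "pawalk_verts (hd vs) ?p = vs @ [hd vs]" using pawalk_verts_snoc p by force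
    moreover have "distinct (tl (vs @ [hd vs]))" using vs by (cases vs) auto
    moreover have "pcas (hd vs) ?p (hd vs)" using p pcas_snoc by force
    moreover have "set ?p \<subseteq> parcs T" using p vs(5) sym by auto
    moreover have "hd vs \<in> pverts T" using vs(5) in_arcsD1 by blast
    ultimately have "cycle ?p" unfolding cycle_def awalk_def by (intro exI[of _ "hd vs"]) auto
    moreover have "3 \<le> length ?p" using length_pawalk_verts[of "hd vs" p] p(3) vs(2) by simp
    ultimately show False using nocyc by blast
  qed
  show ?thesis
  proof
    fix D assume D: "D \<subseteq> pverts T" "D \<noteq> {}" and cl: "\<And>u v. u \<in> D \<Longrightarrow> (u, v) \<in> parcs T \<Longrightarrow> v \<in> D"
    obtain d where d: "d \<in> D" using D by blast
    have "x \<in> D" if x: "x \<in> pverts T" for x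
    proof -
      have "d \<rightarrow>\<^sup>*\<^bsub>with_proj (mk_symmetric (with_proj T))\<^esub> x"
        using assms d D x unfolding undirected_tree_def connected_def strongly_connected_def
        by (auto simp: mk_symmetric_def)
      then have "(d, x) \<in> rtrancl_on (pverts T) (parcs (mk_symmetric (with_proj T)))"
        by (simp add: reachable_def mk_symmetric_def)
      then show ?thesis
        by (induction rule: rtrancl_on_induct) (use d cl sym in \<open>auto simp: mk_symmetric_def\<close>)
    qed
    then show "D = pverts T" using D by blast
  next
    fix Z assume "Z \<subseteq> pverts T" "Z \<noteq> {}"
    moreover have "finite Z" using calculation pair_finite_verts finite_subset by blast
    ultimately show "card (parcs T \<inter> Z \<times> Z) + 2 \<le> 2 * card Z"
    proof (induction "card Z" arbitrary: Z)
      case (Suc n)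
      obtain z where z: "z \<in> Z" "card (parcs T `` {z} \<inter> Z) < 2" using low Suc.prems by blast
      have split: "parcs T \<inter> Z \<times> Z \<subseteq> parcs T \<inter> (Z - {z}) \<times> (Z - {z})
          \<union> (Pair z ` (parcs T `` {z} \<inter> Z) \<union> (\<lambda>y. (y, z)) ` (parcs T `` {z} \<inter> Z))"
        using sym by auto
      have fin: "finite (parcs T `` {z} \<inter> Z)" using Suc.prems by auto
      have "card (parcs T \<inter> Z \<times> Z) \<le> card (parcs T \<inter> (Z - {z}) \<times> (Z - {z}))
          + card (Pair z ` (parcs T `` {z} \<inter> Z) \<union> (\<lambda>y. (y, z)) ` (parcs T `` {z} \<inter> Z))"
        using fin pair_finite_arcs by (intro order.trans[OF card_mono[OF _ split] card_Un_le]) auto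
      also have "\<dots> \<le> card (parcs T \<inter> (Z - {z}) \<times> (Z - {z})) + (card (parcs T `` {z} \<inter> Z) + card (parcs T `` {z} \<inter> Z))"
        using card_Un_le[of "Pair z ` (parcs T `` {z} \<inter> Z)" "(\<lambda>y. (y, z)) ` (parcs T `` {z} \<inter> Z)"]
          card_image_le[OF fin, of "Pair z"] card_image_le[OF fin, of "\<lambda>y. (y, z)"] by linarith
      finally have le: "card (parcs T \<inter> Z \<times> Z) \<le> card (parcs T \<inter> (Z - {z}) \<times> (Z - {z})) + 2"
        using z(2) by linarith
      show ?case
      proof (cases "Z = {z}")
        case True
        then have "parcs T \<inter> Z \<times> Z = {}" using no_loops' by auto
        then show ?thesis using True by simp
      next
        case False
        have c: "card (Z - {z}) = n" "card Z = Suc n" using Suc z by auto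
        have "card (parcs T \<inter> (Z - {z}) \<times> (Z - {z})) + 2 \<le> 2 * card (Z - {z})"
          using False Suc.prems z c by (intro Suc.hyps(1)) auto
        then show ?thesis using le c by linarith
      qed
    qed auto
  qed (use pair_finite_verts in_arcsD1 in_arcsD2 sym irr in auto)
qed

lemma degree_eq: "degree G v = card (parcs G `` {v})"
proof -
  have "out_arcs (with_proj G) v = Pair v ` (parcs G `` {v})" by (auto simp: out_arcs_def)
  moreover have "inj (Pair v)" by (auto intro: injI)
  ultimately show ?thesis unfolding degree_def out_degree_def
    by (simp add: card_image inj_on_def)
qed

text \<open>
  The subtree has as many arcs as the tree can have at all on these vertices.
\<close>

lemma subtree_induced:
  assumes "undirected_tree S" "undirected_tree T" "subgraph (with_proj S) (with_proj T)"
  shows "parcs S = parcs T \<inter> pverts S \<times> pverts S"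
proof -
  interpret S: arc_tree "pverts S" "parcs S" using undirected_tree_arc_tree assms by blast
  interpret T: arc_tree "pverts T" "parcs T" using undirected_tree_arc_tree assms by blast
  have sub: "pverts S \<subseteq> pverts T" "parcs S \<subseteq> parcs T" using assms(3) by (auto simp: subgraph_def)
  have "pverts S \<noteq> {}" using assms(1)
    by (auto simp: undirected_tree_def connected_def strongly_connected_def mk_symmetric_def)
  then have "card (parcs T \<inter> pverts S \<times> pverts S) \<le> card (parcs S)"
    using T.sparse[OF sub(1)] S.many_arcs by linarith
  moreover have "parcs S \<subseteq> parcs T \<inter> pverts S \<times> pverts S" using sub S.arcs_in by auto
  ultimately show ?thesis using T.finite_arcs by (metis card_seteq finite_Int)
qed

lemma undirected_tree_induced:
  assumes T: "undirected_tree T" and A: "arc_tree A (parcs T \<inter> A \<times> A)" "A \<subseteq> pverts T" "A \<noteq> {}"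
  defines "S \<equiv> \<lparr>pverts = A, parcs = parcs T \<inter> A \<times> A\<rparr>"
  shows "undirected_tree S" "subgraph (with_proj S) (with_proj T)"
proof -
  interpret T: pair_graph T using T by (simp add: undirected_tree_def)
  interpret A: arc_tree A "parcs T \<inter> A \<times> A" by fact
  interpret S: pair_graph S
  proof
    show "symmetric (with_proj S)" using A.arcs_sym by (auto simp: symmetric_def sym_def S_def)
  qed (use A.finite_verts A.finite_arcs A.arcs_irrefl in \<open>auto simp: S_def\<close>)
  show sub: "subgraph (with_proj S) (with_proj T)"
    using A(2) S.wf_digraph_axioms T.wf_digraph_axioms by (auto simp: subgraph_def S_def compatible_def)
  have "connected (with_proj S)" unfolding connected_def strongly_connected_def
  proof (intro conjI ballI)
    show "verts (with_proj (mk_symmetric (with_proj S))) \<noteq> {}" using A(3) by (simp add: mk_symmetric_def S_def)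
    fix u v
    assume uv: "u \<in> verts (with_proj (mk_symmetric (with_proj S)))" "v \<in> verts (with_proj (mk_symmetric (with_proj S)))"
    let ?R = "\<lambda>v. (u, v) \<in> rtrancl_on A (parcs (mk_symmetric (with_proj S)))"
    have "{v \<in> A. ?R v} = A"
    proof (rule A.closed_eq)
      show "{v \<in> A. ?R v} \<noteq> {}" using uv by (auto simp: mk_symmetric_def S_def)
      fix a b assume a: "a \<in> {v \<in> A. ?R v}" and ab: "(a, b) \<in> parcs T \<inter> A \<times> A"
      then have "(a, b) \<in> parcs (mk_symmetric (with_proj S))" by (force simp: mk_symmetric_def S_def)
      then show "b \<in> {v \<in> A. ?R v}" using a ab by (auto intro: rtrancl_on_into_rtrancl_on)
    qed auto
    then show "u \<rightarrow>\<^sup>*\<^bsub>with_proj (mk_symmetric (with_proj S))\<^esub> v"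
      using uv by (auto simp: reachable_def mk_symmetric_def S_def)
  qed
  moreover have "\<not> (\<exists>p. pre_digraph.cycle (with_proj S) p \<and> 3 \<le> length p)"
    using T sub T.subgraph_cycle by (auto simp: undirected_tree_def)
  ultimately show "undirected_tree S" using S.pair_graph by (simp add: undirected_tree_def)
qed

section \<open>Lower bound: crossing representations of skeletons\<close>

text \<open>
  A Boolean function on the points stands for the partition of the points into its two sides.
  Two partitions cross if all four cells are nonempty.
\<close>

definition crosses :: "'x set \<Rightarrow> ('x \<Rightarrow> bool) \<Rightarrow> ('x \<Rightarrow> bool) \<Rightarrow> bool" where
  "crosses X A B \<longleftrightarrow> (\<forall>s t. \<exists>e\<in>X. A e = s \<and> B e = t)"

lemma crosses_commD: "crosses X A B \<Longrightarrow> crosses X B A"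
  unfolding crosses_def by (metis (no_types))

lemma crosses_mono:
  assumes "crosses X A B" "X \<subseteq> Y"
  shows "crosses Y A B"
  unfolding crosses_def
proof (intro allI)
  fix s t
  obtain e where "e \<in> X" "A e = s" "B e = t" using assms(1) unfolding crosses_def by metis
  then show "\<exists>e\<in>Y. A e = s \<and> B e = t" using assms(2) by auto
qed

text \<open>
  Deleting a point destroys a crossing only if the point is alone in its cell.
\<close>

lemma alone_in_cell:
  assumes "crosses X A B" "\<not> crosses (X - {a}) A B" "e \<in> X" "A e = A a" "B e = B a"
  shows "e = a"
proof -
  obtain s t where st: "\<And>e. e \<in> X - {a} \<Longrightarrow> A e = s \<Longrightarrow> B e = t \<Longrightarrow> False"
    using assms(2) unfolding crosses_def by metis
  obtain e' where e': "e' \<in> X" "A e' = s" "B e' = t"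
    using assms(1) unfolding crosses_def by metis
  then have "e' = a" using st[of e'] by blast
  then show ?thesis using st[of e] e' assms(3-5) by auto
qed

lemma crosses_imp_card:
  assumes "crosses X A B" "finite X"
  shows "4 \<le> card X"
proof -
  have "UNIV \<subseteq> (\<lambda>e. (A e, B e)) ` X"
  proof
    fix st :: "bool \<times> bool"
    obtain e where "e \<in> X" "A e = fst st" "B e = snd st"
      using assms(1) unfolding crosses_def by metis
    then show "st \<in> (\<lambda>e. (A e, B e)) ` X" by (intro image_eqI[of _ _ e]) auto
  qed
  then have "card (UNIV :: (bool \<times> bool) set) \<le> card X"
    using assms(2) by (meson card_image_le card_mono finite_imageI order.trans)
  moreover have "card (UNIV :: (bool \<times> bool) set) = 4" by (simp add: card_UNIV_bool card_cartesian_product flip: UNIV_Times_UNIV)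
  ultimately show ?thesis by simp
qed

locale cross_tree = arc_tree V E for V :: "'a set" and E +
  fixes X :: "'x set" and F :: "'a \<Rightarrow> 'x \<Rightarrow> bool"
  assumes finite_points: "finite X"
    and rep: "u \<in> V \<Longrightarrow> v \<in> V \<Longrightarrow> (u, v) \<in> E \<longleftrightarrow> crosses X (F u) (F v)"
begin

text \<open>
  The partition of \<open>z\<close> does not separate any two points of the side \<open>s\<close> of \<open>u\<close>.
\<close>

definition const_on :: "'a \<Rightarrow> 'a \<Rightarrow> bool \<Rightarrow> bool" where
  "const_on z u s \<longleftrightarrow> (\<exists>t. \<forall>e\<in>X. F u e = s \<longrightarrow> F z e = t)"

lemma arc_crosses: "(u, v) \<in> E \<Longrightarrow> crosses X (F u) (F v)"
  using rep arcD by blast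

lemma nonadjacent_const:
  assumes "z \<in> V" "u \<in> V" "(z, u) \<notin> E"
  shows "\<exists>s. const_on z u s"
proof -
  obtain s t where st: "\<And>e. e \<in> X \<Longrightarrow> F u e = s \<Longrightarrow> F z e = t \<Longrightarrow> False"
    using rep[OF assms(1,2)] assms(3) unfolding crosses_def by metis
  show ?thesis unfolding const_on_def by (rule exI[of _ s], rule exI[of _ "\<not> t"]) (use st in metis)
qed

text \<open>
  Constancy on a side of \<open>u\<close> spreads along arcs that avoid the neighbourhood of \<open>u\<close>.  The reason is
  that adjacent vertices cannot be constant on opposite sides, since then one of the four cells
  would have no room.
\<close>

lemma const_opposite:
  assumes "(z, z') \<in> E" "const_on z u s" "const_on z' u (\<not> s)"
  shows False
proof -
  obtain t t' where t: "\<And>e. e \<in> X \<Longrightarrow> F u e = s \<Longrightarrow> F z e = t"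
      "\<And>e. e \<in> X \<Longrightarrow> F u e = (\<not> s) \<Longrightarrow> F z' e = t'"
    using assms(2,3) unfolding const_on_def by metis
  obtain e where "e \<in> X" "F z e = (\<not> t)" "F z' e = (\<not> t')"
    using arc_crosses[OF assms(1)] unfolding crosses_def by metis
  then show False using t(1)[of e] t(2)[of e] by auto
qed

lemma const_propagates:
  assumes "(z, z') \<in> E" "(z', u) \<notin> E" "u \<in> V" "const_on z u s"
  shows "const_on z' u s"
proof -
  obtain s' where "const_on z' u s'"
    using nonadjacent_const[OF arcD(2)[OF assms(1)] assms(3,2)] by metis
  then show ?thesis using const_opposite[OF assms(1,4)] by (cases "s' = s") auto
qed

text \<open>
  The deletion step.  If all vertices other than \<open>l\<close> and its neighbour \<open>h\<close> are constant on one side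
  of \<open>l\<close>, then two points \<open>p, q\<close> of this side that are separated by \<open>h\<close> are separated by no
  other remaining vertex.  Crossings that do not involve \<open>h\<close> survive the deletion of \<open>p\<close> as well as that of
  \<open>q\<close>.  If both deletions destroyed a crossing of \<open>h\<close>, with \<open>y\<close> and \<open>y'\<close> respectively, then since
  \<open>y\<close> and \<open>y'\<close> do not cross, \<open>{p, q}\<close> would contain a whole side of one of them (or a crossing
  of \<open>h\<close> would already be missing), and that vertex could not cross its neighbours other than \<open>h\<close>.
\<close>

lemma prune_leaf:
  assumes l: "E `` {l} = {h}"
    and const: "\<And>z. z \<in> V \<Longrightarrow> z \<noteq> l \<Longrightarrow> z \<noteq> h \<Longrightarrow> const_on z l s"
    and next_nbr: "\<And>y. (h, y) \<in> E \<Longrightarrow> y \<noteq> l \<Longrightarrow> \<exists>z. z \<noteq> h \<and> (y, z) \<in> E"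
  shows "\<exists>e\<in>X. cross_tree (V - {l}) (E \<inter> (V - {l}) \<times> (V - {l})) (X - {e}) F"
proof -
  have lh: "(l, h) \<in> E" using l by blast
  have V: "l \<in> V" "h \<in> V" using arcD lh by auto
  obtain p q where p: "p \<in> X" "F l p = s" "F h p" and q: "q \<in> X" "F l q = s" "\<not> F h q"
    using arc_crosses[OF lh] unfolding crosses_def by metis
  have pq: "F z p = F z q" if "z \<in> V" "z \<noteq> l" "z \<noteq> h" for z
    using const[OF that] p q unfolding const_on_def by metis
  have not_l: "z \<noteq> l" if "(y, z) \<in> E" "y \<noteq> h" for y z
    using that l arcs_sym by blast
  (* A side of y contained in {p, q} is separated by no neighbour of y other than h. *)
  have thin: False if yh: "(h, y) \<in> E" "y \<noteq> l" and sub: "\<And>e. e \<in> X \<Longrightarrow> F y e = F y p \<Longrightarrow> e = p \<or> e = q" for y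
  proof -
    obtain z where z: "z \<noteq> h" "(y, z) \<in> E" using next_nbr[OF yh] by blast
    have "z \<noteq> l" using z(2) not_l yh arcD(3) by blast
    then have eq: "F z p = F z q" using pq z arcD by blast
    obtain e where "e \<in> X" "F y e = F y p" "F z e \<noteq> F z p"
      using arc_crosses[OF z(2)] unfolding crosses_def by metis
    then show False using sub[of e] eq by auto
  qed
  have two: "\<exists>e\<in>{p, q}. \<forall>y. (h, y) \<in> E \<longrightarrow> y \<noteq> l \<longrightarrow> crosses (X - {e}) (F h) (F y)"
  proof (rule ccontr)
    assume "\<not> ?thesis"
    then obtain y y' where y: "(h, y) \<in> E" "y \<noteq> l" "\<not> crosses (X - {p}) (F h) (F y)"
      and y': "(h, y') \<in> E" "y' \<noteq> l" "\<not> crosses (X - {q}) (F h) (F y')"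
      by auto
    have y_pq: "F y p = F y q" "F y' p = F y' q" using pq y y' arcD by metis+
    have alone_p: "e = p" if "e \<in> X" "F h e" "F y e = F y p" for e
      using alone_in_cell[OF arc_crosses[OF y(1)] y(3)] that p by auto
    have alone_q: "e = q" if "e \<in> X" "\<not> F h e" "F y' e = F y' p" for e
      using alone_in_cell[OF arc_crosses[OF y'(1)] y'(3)] that q y_pq by auto
    have "(y, y') \<notin> E" using no_triangle y y' by blast
    (* The cell of y and y' with the values a and b is the empty one. *)
    then obtain a b where ab: "\<And>e. e \<in> X \<Longrightarrow> F y e = a \<Longrightarrow> F y' e = b \<Longrightarrow> False"
      using rep[of y y'] y y' arcD unfolding crosses_def by metis
    consider "a = F y p" "b = (\<not> F y' p)" | "a = (\<not> F y p)" "b = F y' p"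
      | "a = (\<not> F y p)" "b = (\<not> F y' p)"
      using ab[OF p(1)] by blast
    then show False
    proof cases
      case 1
      show False by (rule thin[OF y(1,2)]) (use 1 ab alone_p alone_q in blast)
    next
      case 2
      show False by (rule thin[OF y'(1,2)]) (use 2 ab alone_p alone_q in blast)
    next
      case 3
      obtain e where "e \<in> X" "F h e" "F y' e = b"
        using arc_crosses[OF y'(1)] unfolding crosses_def by metis
      then show False using alone_p[of e] ab[of e] 3 by blast
    qed
  qed
  then obtain e where e: "e \<in> {p, q}"
    and h: "\<And>y. (h, y) \<in> E \<Longrightarrow> y \<noteq> l \<Longrightarrow> crosses (X - {e}) (F h) (F y)" by blast
  interpret L: arc_tree "V - {l}" "E \<inter> (V - {l}) \<times> (V - {l})" using remove_leaf V l by blast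
  have keep: "crosses (X - {e}) (F y) (F z)" if yz: "(y, z) \<in> E" "y \<noteq> l" "z \<noteq> l" for y z
  proof (cases "y = h \<or> z = h")
    case True
    then show ?thesis using h yz arcs_sym crosses_commD by metis
  next
    case False
    then have "F y p = F y q" "F z p = F z q" using yz pq arcD by metis+
    then have eq: "F y e = F y p" "F z e = F z p" "F y e = F y q" "F z e = F z q" using e by auto
    have "p \<noteq> q" using p q by auto
    then show ?thesis using alone_in_cell[OF arc_crosses[OF yz(1)], of e] eq p(1) q(1) e by metis
  qed
  have "cross_tree (V - {l}) (E \<inter> (V - {l}) \<times> (V - {l})) (X - {e}) F"
  proof
    show "finite (X - {e})" using finite_points by simp
    fix u v assume uv: "u \<in> V - {l}" "v \<in> V - {l}"
    show "(u, v) \<in> E \<inter> (V - {l}) \<times> (V - {l}) \<longleftrightarrow> crosses (X - {e}) (F u) (F v)"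
      using keep[of u v] rep[of u v] crosses_mono[of "X - {e}" "F u" "F v" X] uv by blast
  qed
  then show ?thesis using e p q by blast
qed

end

definition skeletal :: "('a \<times> 'a) set \<Rightarrow> bool" where
  "skeletal E \<longleftrightarrow> (\<forall>w u. card (E `` {w}) = 1 \<and> (w, u) \<in> E \<longrightarrow> card (E `` {u}) = 2)"

context arc_tree
begin

text \<open>
  A leaf \<open>w\<close> of a skeleton, its neighbour \<open>u\<close>, and the other neighbour \<open>x\<close> of \<open>u\<close>.
\<close>

definition pendant :: "'a \<Rightarrow> 'a \<Rightarrow> 'a \<Rightarrow> bool" where
  "pendant w u x \<longleftrightarrow> w \<noteq> x \<and> E `` {w} = {u} \<and> E `` {u} = {w, x}"

lemma leaf_pendant:
  assumes "skeletal E" "card (E `` {w}) = 1"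
  shows "\<exists>u x. pendant w u x"
proof -
  obtain u where u: "E `` {w} = {u}" using assms(2) card_1_singletonE by blast
  then have "card (E `` {u}) = 2" using assms unfolding skeletal_def by blast
  moreover have "w \<in> E `` {u}" using u arcs_sym by blast
  ultimately obtain a b where "E `` {u} = {a, b}" "a \<noteq> b" "w \<in> {a, b}"
    unfolding card_2_iff by blast
  then obtain x where "E `` {u} = {w, x}" "w \<noteq> x"
    by (cases "w = a") (auto simp: insert_commute)
  then have "pendant w u x" using u unfolding pendant_def by simp
  then show ?thesis by blast
qed

lemma pendant_exists:
  assumes "skeletal E" "3 \<le> card V"
  shows "\<exists>w u x. pendant w u x"
proof -
  have "V \<noteq> {}" using assms by auto
  then obtain w where w: "w \<in> V" "card (E `` {w} \<inter> V) \<le> 1" using ex_low_degree[of V] by blast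
  moreover have "E `` {w} \<inter> V = E `` {w}" using arcs_in by auto
  moreover have "card (E `` {w}) \<noteq> 0" using nbr_exists[OF w(1)] assms(2) finite_nbrs by auto
  ultimately have "card (E `` {w}) = 1" by simp
  then show ?thesis using leaf_pendant assms(1) by blast
qed

lemma pendantD:
  assumes "pendant w u x"
  shows "(w, u) \<in> E" "(u, w) \<in> E" "(u, x) \<in> E" "(x, u) \<in> E" "w \<in> V" "u \<in> V" "x \<in> V"
    "w \<noteq> u" "u \<noteq> x" "w \<noteq> x"
proof -
  show "(w, u) \<in> E" "(u, w) \<in> E" "(u, x) \<in> E" "w \<noteq> x" using assms unfolding pendant_def by auto
  then show "(x, u) \<in> E" "w \<in> V" "u \<in> V" "x \<in> V" "w \<noteq> u" "u \<noteq> x" using arcD arcs_sym by blast+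
qed

lemma pendant_next:
  assumes p: "pendant w u x" and "4 \<le> card V"
  shows "\<exists>z. z \<noteq> u \<and> (x, z) \<in> E"
proof (rule ccontr)
  assume "\<not> ?thesis"
  then have "{w, u, x} = V"
    using p pendantD[OF p] by (intro closed_eq) (auto simp: pendant_def)
  moreover have "card {w, u, x} \<le> 3" by (simp add: card_insert_if)
  ultimately show False using assms(2) by auto
qed

text \<open>
  The set \<open>Z\<close> is a union of branches at \<open>x\<close>, so counting the arcs within \<open>Z\<close> and \<open>x\<close> shows that it
  contains a leaf.  The neighbour of that leaf has degree 2, so it is not \<open>x\<close>.
\<close>

lemma pendant_far_leaf:
  assumes p: "pendant w u x" and x: "card (E `` {x}) \<noteq> 2" and sk: "skeletal E"
    and Z: "Z \<subseteq> V - {w, u, x}" "Z \<noteq> {}"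
    and cl: "\<And>z z'. z \<in> Z \<Longrightarrow> (z, z') \<in> E \<Longrightarrow> z' \<noteq> x \<Longrightarrow> z' \<in> Z"
  shows "\<exists>w' u' x'. pendant w' u' x' \<and> u' \<in> Z"
proof -
  note pd = pendantD[OF p]
  let ?Z = "insert x Z"
  have fin: "finite Z" using Z finite_verts finite_subset by blast
  have xZ: "x \<notin> Z" using Z by auto
  have sub: "E `` {z} \<subseteq> ?Z" if "z \<in> Z" for z using cl that by blast
  obtain y where y: "(x, y) \<in> E" "y \<in> Z"
  proof -
    have "Z \<noteq> V" using Z pd by blast
    then show thesis using closed_eq[of Z] Z cl arcs_sym that by blast
  qed
  have "\<exists>z\<in>Z. card (E `` {z}) \<le> 1"
  proof (rule ccontr)
    assume "\<not> ?thesis"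
    then have "(\<Sum>z\<in>Z. 2) \<le> (\<Sum>z\<in>Z. card (E `` {z}))" by (intro sum_mono) force
    also have "\<dots> = (\<Sum>z\<in>Z. card (E `` {z} \<inter> ?Z))"
      using sub by (intro sum.cong) (auto simp: Int_absorb2)
    finally have "2 * card Z \<le> (\<Sum>z\<in>Z. card (E `` {z} \<inter> ?Z))" by simp
    moreover have "1 \<le> card (E `` {x} \<inter> ?Z)"
      using y finite_nbrs by (metis Image_singleton_iff Int_iff One_nat_def Suc_leI card_gt_0_iff empty_iff finite_Int insertCI)
    moreover have "card (E \<inter> ?Z \<times> ?Z) = card (E `` {x} \<inter> ?Z) + (\<Sum>z\<in>Z. card (E `` {z} \<inter> ?Z))"
      using arcs_within_eq_sum[of ?Z] fin xZ by simp
    moreover have "card (E \<inter> ?Z \<times> ?Z) + 2 \<le> 2 * card ?Z" using Z pd by (intro sparse) auto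
    ultimately show False using fin xZ by simp
  qed
  then obtain z where z: "z \<in> Z" "card (E `` {z}) \<le> 1" by blast
  have "2 \<le> card V" using pd card_mono[of V "{w,u}"] finite_verts by auto
  then have "E `` {z} \<noteq> {}" using nbr_exists[of z] z Z by blast
  then have "card (E `` {z}) = 1" using z finite_nbrs[of z] by (metis One_nat_def card_0_eq le_SucE le_zero_eq)
  then obtain u' x' where p': "pendant z u' x'" using leaf_pendant sk by blast
  have "u' \<noteq> x" using p' x unfolding pendant_def by auto
  then have "u' \<in> Z" using cl[OF z(1)] pendantD[OF p'] by blast
  then show ?thesis using p' by blast
qed

end

text \<open>
  The graph without \<open>w\<close> and \<open>u\<close> is connected, so the side of \<open>w\<close> on which \<open>x\<close> is constant works for
  all other vertices.
\<close>

lemma (in cross_tree) pendant_leaf_const: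
  assumes p: "pendant w u x"
  shows "\<exists>s. \<forall>z\<in>V. z \<noteq> w \<longrightarrow> z \<noteq> u \<longrightarrow> const_on z w s"
proof -
  note pd = pendantD[OF p]
  have nw: "(z, w) \<notin> E" if "z \<noteq> u" for z using p that arcs_sym unfolding pendant_def by blast
  obtain s where s: "const_on x w s"
    using nonadjacent_const[OF pd(7,5) nw] pd by metis
  (* With u and w included the set is closed. *)
  let ?D = "{z \<in> V. const_on z w s} \<union> {u, w}"
  have "?D = V"
  proof (rule closed_eq)
    fix a b assume ab: "a \<in> ?D" "(a, b) \<in> E"
    consider "a = u" | "a = w" | "a \<noteq> u" "a \<noteq> w" "const_on a w s" using ab by blast
    then show "b \<in> ?D"
    proof cases
      case 1
      then show ?thesis using p ab s pd unfolding pendant_def by auto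
    next
      case 2
      then show ?thesis using p ab unfolding pendant_def by auto
    next
      case 3
      then show ?thesis using const_propagates[OF ab(2) nw pd(5)] ab(2) arcD by blast
    qed
  qed (use pd in auto)
  then show ?thesis by (intro exI[of _ s]) auto
qed

text \<open>
  Removing \<open>u\<close>, \<open>w\<close> and \<open>x\<close> may leave many components, and each of them is constant on one of the two
  sides of \<open>u\<close>.  A component \<open>Z\<close> that is not constant on the smallest side contains a vertex \<open>u'\<close> of the
  same kind as \<open>u\<close>, and \<open>u'\<close> has a side within that of \<open>u\<close>.  By minimality these sides agree, so \<open>u'\<close>
  crosses \<open>w\<close>, although \<open>u\<close> is the only neighbour of \<open>w\<close>.
\<close>

lemma (in cross_tree) smallest_side_const:
  assumes p: "pendant w u x" and x: "card (E `` {x}) \<noteq> 2" and sk: "skeletal E"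
    and min: "\<And>w' u' x' s'. pendant w' u' x' \<Longrightarrow> card {e \<in> X. F u e = s} \<le> card {e \<in> X. F u' e = s'}"
    and z: "z \<in> V" "z \<notin> {w, u, x}"
  shows "const_on z u s"
proof (rule ccontr)
  assume nz: "\<not> const_on z u s"
  note pd = pendantD[OF p]
  have nu: "(y, u) \<notin> E" if "y \<notin> {w, x}" for y using p that arcs_sym unfolding pendant_def by blast
  (* All vertices of Z are constant on the other side of u, so Z is a union of components. *)
  define Z where "Z = {y \<in> V - {w, u, x}. \<not> const_on y u s}"
  have inside: "const_on y u (\<not> s)" if "y \<in> Z" for y
  proof -
    have "y \<in> V" "(y, u) \<notin> E" using that nu unfolding Z_def by auto
    then obtain s' where "const_on y u s'" using nonadjacent_const pd by metis
    then show ?thesis using that unfolding Z_def by (cases "s' = s") auto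
  qed
  have cl: "y' \<in> Z" if y: "y \<in> Z" "(y, y') \<in> E" "y' \<noteq> x" for y y'
  proof -
    have "y' \<noteq> w" "y' \<noteq> u" using y p arcs_sym unfolding pendant_def Z_def by blast+
    moreover have "\<not> const_on y' u s"
      using const_opposite[of y y' u "\<not> s"] inside y by auto
    ultimately show ?thesis using y arcD(2) unfolding Z_def by blast
  qed
  have "\<exists>w' u' x'. pendant w' u' x' \<and> u' \<in> Z"
    by (rule pendant_far_leaf[OF p x sk _ _ cl]) (use z nz in \<open>auto simp: Z_def\<close>)
  then obtain w' u' x' where p': "pendant w' u' x'" and u': "u' \<in> Z" by blast
  obtain t where t: "\<And>e. e \<in> X \<Longrightarrow> F u e = (\<not> s) \<Longrightarrow> F u' e = t"
    using inside[OF u'] unfolding const_on_def by metis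
  have sub: "{e \<in> X. F u' e = (\<not> t)} \<subseteq> {e \<in> X. F u e = s}" using t by auto
  have eq: "{e \<in> X. F u' e = (\<not> t)} = {e \<in> X. F u e = s}"
    using card_seteq[OF _ sub] min[OF p', of "\<not> t"] finite_points by simp
  have "crosses X (F u') (F w)" unfolding crosses_def
  proof (intro allI)
    fix a b
    obtain e where "e \<in> X" "F u e = (if a = (\<not> t) then s else \<not> s)" "F w e = b"
      using arc_crosses[OF pd(2)] unfolding crosses_def by metis
    then show "\<exists>e\<in>X. F u' e = a \<and> F w e = b" using eq by (intro bexI[of _ e]) (auto split: if_splits)
  qed
  then have "(u', w) \<in> E" using rep[of u' w] u' pd by (auto simp: Z_def)
  then show False using p u' arcs_sym unfolding pendant_def Z_def by blast
qed

text \<open>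
  Induction on the number of vertices.  The size of the smallest side has to be compared before anything is
  deleted: constancy on a side is inherited by smaller sets of points, minimality is not.
\<close>

lemma cross_tree_lower_bound:
  assumes "cross_tree V E X F" "skeletal E" "3 \<le> card V"
  shows "card V + 1 \<le> card X"
  using assms
proof (induction "card V" arbitrary: V E X rule: less_induct)
  case less
  interpret cross_tree V E X F by fact
  note sk = less.prems(2)
  show ?case
  proof (cases "card V = 3")
    case True
    obtain w u x where "pendant w u x" using pendant_exists sk less.prems(3) by blast
    then have "crosses X (F w) (F u)" using arc_crosses pendantD by blast
    then show ?thesis using crosses_imp_card finite_points True by auto
  next
    case False
    then have n4: "4 \<le> card V" using less.prems(3) by simp
    (* Among all pendant paths and both sides, choose a smallest side of a middle vertex. *)
    let ?P = "\<lambda>(w, u, x, s). pendant w u x"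
    let ?m = "\<lambda>(w, u, x, s). card {e \<in> X. F u e = s}"
    obtain w0 u0 x0 where "pendant w0 u0 x0" using pendant_exists sk less.prems(3) by blast
    then have "?P (w0, u0, x0, True)" by simp
    then obtain m where m: "?P m" "\<forall>m'. ?P m' \<longrightarrow> ?m m \<le> ?m m'"
      using ex_has_least_nat[of ?P _ ?m] by blast
    obtain w u x s where wuxs: "m = (w, u, x, s)" by (metis prod_cases4)
    have p: "pendant w u x" using m(1) wuxs by simp
    have min: "\<And>w' u' x' s'. pendant w' u' x' \<Longrightarrow> card {e \<in> X. F u e = s} \<le> card {e \<in> X. F u' e = s'}"
      using m(2) wuxs by fastforce
    note pd = pendantD[OF p]
    have w: "E `` {w} = {u}" and u: "E `` {u} = {w, x}" using p unfolding pendant_def by auto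
    have only_u: "y = u" if "(y, w) \<in> E" for y using w arcs_sym that by blast
    have u_nbrs: "y \<in> {w, x}" if "(y, u) \<in> E" for y using u arcs_sym that by blast
    let ?V1 = "V - {w}" and ?E1 = "E \<inter> (V - {w}) \<times> (V - {w})"
    obtain \<sigma> where \<sigma>: "\<And>z. z \<in> V \<Longrightarrow> z \<noteq> w \<Longrightarrow> z \<noteq> u \<Longrightarrow> const_on z w \<sigma>"
      using pendant_leaf_const[OF p] by metis
    have "\<exists>e\<in>X. cross_tree ?V1 ?E1 (X - {e}) F"
      by (rule prune_leaf[OF w \<sigma>]) (use u pendant_next[OF p n4] in auto)
    then obtain e where e: "e \<in> X" and T1: "cross_tree ?V1 ?E1 (X - {e}) F" by blast
    interpret T1: cross_tree ?V1 ?E1 "X - {e}" F by fact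
    have cV1: "card ?V1 = card V - 1" and cX1: "card (X - {e}) = card X - 1"
      using pd e by auto
    have X0: "card X > 0" using e finite_points by (auto simp: card_gt_0_iff)
    have E1: "?E1 `` {v} = E `` {v}" if "v \<notin> {w, u}" for v
      using that only_u arcD by blast
    have E1u: "?E1 `` {u} = {x}" using u pd by blast
    show ?thesis
    proof (cases "card (E `` {x}) = 2")
      case True
      have "skeletal ?E1" unfolding skeletal_def
      proof (intro allI impI, elim conjE)
        fix l v assume l: "card (?E1 `` {l}) = 1" and lv: "(l, v) \<in> ?E1"
        show "card (?E1 `` {v}) = 2"
        proof (cases "l = u")
          case True
          then have "v = x" using lv E1u by blast
          moreover have "x \<notin> {w, u}" using pd by blast
          ultimately show ?thesis using \<open>card (E `` {x}) = 2\<close> E1[of x] by metis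
        next
          case False
          have lw: "l \<noteq> w" using lv by blast
          have "card (E `` {l}) = 1" using l E1[of l] False lw by simp
          moreover have "(l, v) \<in> E" using lv by blast
          ultimately have v2: "card (E `` {v}) = 2" using sk unfolding skeletal_def by blast
          have "v \<noteq> u"
          proof
            assume "v = u"
            then have "l = x" using u_nbrs lv lw by blast
            then show False using True \<open>card (E `` {l}) = 1\<close> by simp
          qed
          moreover have "v \<noteq> w" using lv by blast
          ultimately show ?thesis using v2 E1[of v] by simp
        qed
      qed
      then have "card ?V1 + 1 \<le> card (X - {e})"
        using cV1 n4 by (intro less.hyps[OF _ T1]) auto
      then show ?thesis using cV1 cX1 n4 X0 by linarith
    next
      case x2: False
      let ?V2 = "?V1 - {u}" and ?E2 = "?E1 \<inter> (?V1 - {u}) \<times> (?V1 - {u})"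
      (* As x does not have degree 2, no leaf is adjacent to x, so u can be removed as well. *)
      have deg: "card (E `` {v}) \<noteq> 1" if v: "(x, v) \<in> E" for v
        using sk x2 arcs_sym[OF v] unfolding skeletal_def by blast
      have next_nbr: "\<exists>z. z \<noteq> x \<and> (y, z) \<in> ?E1" if y: "(x, y) \<in> ?E1" "y \<noteq> u" for y
      proof (rule ccontr)
        assume "\<nexists>z. z \<noteq> x \<and> (y, z) \<in> ?E1"
        then have "?E1 `` {y} = {x}" using y arcs_sym by blast
        moreover have "y \<notin> {w, u}" using y by blast
        ultimately have "card (E `` {y}) = 1" using E1 by simp
        then show False using deg y by blast
      qed
      (* After the removal of w, the vertex u is a leaf with neighbour x. *)
      have "\<exists>e'\<in>X - {e}. cross_tree ?V2 ?E2 (X - {e} - {e'}) F"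
      proof (rule T1.prune_leaf[OF E1u _ next_nbr])
        fix z assume "z \<in> ?V1" "z \<noteq> u" "z \<noteq> x"
        then have "const_on z u s" by (intro smallest_side_const[OF p x2 sk min]) auto
        then show "T1.const_on z u s" unfolding const_on_def T1.const_on_def by (metis DiffD1)
      qed
      then obtain e' where e': "e' \<in> X - {e}" and T2: "cross_tree ?V2 ?E2 (X - {e} - {e'}) F" by blast
      have x3: "3 \<le> card (E `` {x})"
      proof -
        obtain z where z: "z \<noteq> u" "(x, z) \<in> E" using pendant_next[OF p n4] by blast
        have "{u, z} \<subseteq> E `` {x}" using z pd by auto
        then have "card {u, z} \<le> card (E `` {x})" using finite_nbrs by (intro card_mono) auto
        then show ?thesis using z x2 by simp
      qed
      have E2: "?E2 `` {v} = E `` {v}" if "v \<notin> {w, u, x}" for v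
        using that only_u u_nbrs arcD by blast
      have "?E2 `` {x} = E `` {x} - {u}" using only_u arcD pd by blast
      then have E2x: "2 \<le> card (?E2 `` {x})" using x3 pd finite_nbrs by (simp add: card_Diff_singleton)
      have c2: "3 \<le> card ?V2"
      proof -
        have "insert x (?E2 `` {x}) \<subseteq> ?V2" using pd by auto
        then have "card (insert x (?E2 `` {x})) \<le> card ?V2" using finite_verts by (intro card_mono) auto
        moreover have "x \<notin> ?E2 `` {x}" using arcs_irrefl by auto
        moreover have "finite (?E2 `` {x})" using finite_nbrs[of x] by (auto intro: finite_subset)
        ultimately show ?thesis using E2x by simp
      qed
      have "skeletal ?E2" unfolding skeletal_def
      proof (intro allI impI, elim conjE)
        fix l v assume l: "card (?E2 `` {l}) = 1" and lv: "(l, v) \<in> ?E2"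
        have lx: "l \<noteq> x" using l E2x by auto
        have lE: "l \<notin> {w, u}" "v \<notin> {w, u}" "(l, v) \<in> E" using lv by auto
        have "card (E `` {l}) = 1" using l E2[of l] lx lE by simp
        then have v2: "card (E `` {v}) = 2" using sk lE unfolding skeletal_def by blast
        then show "card (?E2 `` {v}) = 2" using E2[of v] x2 lE by (cases "v = x") auto
      qed
      then have "card ?V2 + 1 \<le> card (X - {e} - {e'})"
        using c2 cV1 n4 pd by (intro less.hyps[OF _ T2]) auto
      moreover have "card ?V2 = card V - 2" using pd by simp
      moreover have "card (X - {e} - {e'}) = card X - 2" using e e' by simp
      ultimately show ?thesis using c2 n4 by linarith
    qed
  qed
qed

text \<open>
  The point \<open>None\<close>, which lies in no set, fills the fourth cell of each pair.
\<close>

lemma overlap_rep_imp_cross_tree: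
  assumes T: "arc_tree V E"
    and fin: "\<And>v. v \<in> V \<Longrightarrow> finite (f v)"
    and rep: "\<And>u v. u \<in> V \<Longrightarrow> v \<in> V \<Longrightarrow> u \<noteq> v \<Longrightarrow> (u, v) \<in> E \<longleftrightarrow> overlap (f u) (f v)"
  defines "U \<equiv> \<Union>v\<in>V. f v"
  shows "cross_tree V E (insert None (Some ` U)) (\<lambda>v e. e \<in> Some ` f v)"
proof -
  interpret arc_tree V E by fact
  have iff: "crosses (insert None (Some ` U)) (\<lambda>e. e \<in> Some ` f u) (\<lambda>e. e \<in> Some ` f v) \<longleftrightarrow> overlap (f u) (f v)"
    (is "?L \<longleftrightarrow> ?R") if "u \<in> V" "v \<in> V" for u v
  proof
    assume ?L
    then have "\<exists>e. e \<in> Some ` f u \<and> e \<in> Some ` f v" "\<exists>e. e \<in> Some ` f u \<and> e \<notin> Some ` f v"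
        "\<exists>e. e \<notin> Some ` f u \<and> e \<in> Some ` f v"
      unfolding crosses_def by metis+
    then show ?R unfolding overlap_def by auto
  next
    assume ?R
    then obtain a b c where abc: "a \<in> f u" "a \<in> f v" "b \<in> f u" "b \<notin> f v" "c \<notin> f u" "c \<in> f v"
      unfolding overlap_def by blast
    then have "a \<in> U" "b \<in> U" "c \<in> U" using that unfolding U_def by blast+
    let ?X = "insert None (Some ` U)"
    have 1: "\<exists>e\<in>?X. e \<in> Some ` f u \<and> e \<in> Some ` f v"
      using abc \<open>a \<in> U\<close> by (intro bexI[of _ "Some a"]) auto
    have 2: "\<exists>e\<in>?X. e \<in> Some ` f u \<and> e \<notin> Some ` f v"
      using abc \<open>b \<in> U\<close> by (intro bexI[of _ "Some b"]) auto
    have 3: "\<exists>e\<in>?X. e \<notin> Some ` f u \<and> e \<in> Some ` f v"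
      using abc \<open>c \<in> U\<close> by (intro bexI[of _ "Some c"]) auto
    have 4: "\<exists>e\<in>?X. e \<notin> Some ` f u \<and> e \<notin> Some ` f v"
      by (intro bexI[of _ None]) auto
    show ?L unfolding crosses_def
    proof (intro allI)
      fix s t
      show "\<exists>e\<in>?X. (e \<in> Some ` f u) = s \<and> (e \<in> Some ` f v) = t"
        by (cases s; cases t) (use 1 2 3 4 in \<open>simp_all only: simp_thms\<close>)
    qed
  qed
  show ?thesis
  proof
    show "finite (insert None (Some ` U))" using fin finite_verts unfolding U_def by auto
    fix u v assume uv: "u \<in> V" "v \<in> V"
    show "(u, v) \<in> E \<longleftrightarrow> crosses (insert None (Some ` U)) (\<lambda>e. e \<in> Some ` f u) (\<lambda>e. e \<in> Some ` f v)"
      using iff[OF uv] rep[OF uv] arcs_irrefl by (cases "u = v") (auto simp: overlap_def)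
  qed
qed

lemma skeleton_lower_bound:
  assumes "undirected_tree T" "skeleton S" "subgraph (with_proj S) (with_proj T)"
    and "3 \<le> card (pverts S)" "finite_overlap_rep T f"
  shows "card (pverts S) \<le> rep_size T f"
proof -
  have S: "undirected_tree S" using assms(2) unfolding skeleton_def by blast
  interpret arc_tree "pverts S" "parcs S" using undirected_tree_arc_tree S by blast
  interpret T: arc_tree "pverts T" "parcs T" using undirected_tree_arc_tree assms(1) by blast
  have sub: "pverts S \<subseteq> pverts T" using assms(3) by (auto simp: subgraph_def)
  have ind: "parcs S = parcs T \<inter> pverts S \<times> pverts S" using subtree_induced S assms by blast
  let ?U = "\<Union>v\<in>pverts S. f v"
  have "cross_tree (pverts S) (parcs S) (insert None (Some ` ?U)) (\<lambda>v e. e \<in> Some ` f v)"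
  proof (rule overlap_rep_imp_cross_tree[OF arc_tree_axioms])
    fix u v assume uv: "u \<in> pverts S" "v \<in> pverts S" "u \<noteq> v"
    then have "(u, v) \<in> parcs T \<longleftrightarrow> overlap (f u) (f v)"
      using assms(5) sub unfolding finite_overlap_rep_def overlap_rep_def by blast
    then show "(u, v) \<in> parcs S \<longleftrightarrow> overlap (f u) (f v)" using uv by (simp add: ind)
  qed (use assms(5) sub in \<open>auto simp: finite_overlap_rep_def\<close>)
  moreover have "skeletal (parcs S)"
    using assms(2) arcD unfolding skeletal_def skeleton_def leaf_def degree_eq by blast
  ultimately have "card (pverts S) + 1 \<le> card (insert None (Some ` ?U))"
    using cross_tree_lower_bound assms(4) by blast
  moreover have fin: "finite (\<Union>v\<in>pverts T. f v)"
    using assms(5) T.finite_verts by (auto simp: finite_overlap_rep_def)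
  then have "finite ?U" using sub by (meson UN_mono finite_subset order_refl)
  then have "card (insert None (Some ` ?U)) = card ?U + 1" by (simp add: card_image)
  moreover have "card ?U \<le> rep_size T f" unfolding rep_size_def
    using fin sub by (intro card_mono) auto
  ultimately show ?thesis by simp
qed

section \<open>Inner vertices\<close>

locale big_tree = arc_tree V E for V :: "'a set" and E +
  assumes three: "3 \<le> card V"
begin

definition inner :: "'a set" where
  "inner = {v \<in> V. 2 \<le> card (E `` {v})}"

lemma inner_sub: "inner \<subseteq> V" by (auto simp: inner_def)

lemma finite_inner: "finite inner" using inner_sub finite_verts finite_subset by blast

lemma leaf_nbr:
  assumes "w \<in> V - inner"
  shows "\<exists>u\<in>inner. E `` {w} = {u}"
proof -
  have "E `` {w} \<noteq> {}" using nbr_exists[of w] assms three by auto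
  then have "card (E `` {w}) \<noteq> 0" using finite_nbrs by auto
  then have "card (E `` {w}) = 1" using assms by (auto simp: inner_def)
  then obtain u where u: "E `` {w} = {u}" using card_1_singletonE by blast
  have V: "w \<in> V" "u \<in> V" using assms u arcD by blast+
  have "u \<in> inner"
  proof (rule ccontr)
    assume "u \<notin> inner"
    then have "card (E `` {u}) \<le> 1" using V by (auto simp: inner_def)
    moreover have "w \<in> E `` {u}" using u arcs_sym by blast
    ultimately have "E `` {u} = {w}" using finite_nbrs[of u]
      by (metis One_nat_def card_le_Suc0_iff_eq is_singletonI' is_singleton_the_elem singletonD empty_iff)
    then have "{u, w} = V" using u V by (intro closed_eq) auto
    moreover have "card {u, w} \<le> 2" by (simp add: card_insert_if)
    ultimately show False using three by auto
  qed
  then show ?thesis using u by blast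
qed

lemma leaf_nbr_unique:
  assumes "w \<in> V - inner" "(u, w) \<in> E" "(u', w) \<in> E"
  shows "u = u'" "u \<in> inner"
proof -
  obtain x where "x \<in> inner" "E `` {w} = {x}" using leaf_nbr[OF assms(1)] by blast
  moreover from this have "u \<in> {x}" "u' \<in> {x}" using assms(2,3)[THEN arcs_sym] by blast+
  ultimately show "u = u'" "u \<in> inner" by simp_all
qed

text \<open>
  A leaf outside of \<open>A\<close> hangs at a vertex of \<open>A\<close>, so removing such leaves keeps the graph connected.
\<close>

lemma inner_plus_leaves_tree:
  assumes "inner \<subseteq> A" "A \<subseteq> V"
  shows "arc_tree A (E \<inter> A \<times> A)"
proof (rule induced)
  fix D assume D: "D \<subseteq> A" "D \<noteq> {}" and cl: "\<And>u v. u \<in> D \<Longrightarrow> v \<in> A \<Longrightarrow> (u, v) \<in> E \<Longrightarrow> v \<in> D"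
  (* Adding the leaves outside of A whose neighbour is in D gives a set that is closed in the whole tree. *)
  let ?D = "D \<union> {w \<in> V - A. E `` {w} \<subseteq> D}"
  have "?D = V"
  proof (rule closed_eq)
    fix u v assume uv: "u \<in> ?D" "(u, v) \<in> E"
    show "v \<in> ?D"
    proof (cases "v \<in> A")
      case True
      then show ?thesis using uv cl by blast
    next
      case False
      then have v: "v \<in> V - inner" using uv arcD assms by blast
      then have "u \<in> inner" using leaf_nbr_unique uv by blast
      then have "u \<in> D" using uv assms by blast
      moreover have "u' = u" if "(v, u') \<in> E" for u'
        using leaf_nbr_unique(1)[OF v uv(2) arcs_sym[OF that]] by simp
      ultimately show ?thesis using False v by auto
    qed
  qed (use D assms in auto)
  then show "D = A" using D assms by blast
qed (use assms in auto)

lemma inner_nonempty: "inner \<noteq> {}"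
proof -
  have "V \<noteq> {}" using three by auto
  then show ?thesis using leaf_nbr by blast
qed

lemma inner_end_exists: "\<exists>r\<in>inner. card (E `` {r} \<inter> inner) \<le> 1"
  using ex_low_degree[OF inner_sub inner_nonempty] .

lemma inner_closed_eq:
  assumes "D \<subseteq> inner" "D \<noteq> {}" "\<And>u v. u \<in> D \<Longrightarrow> v \<in> inner \<Longrightarrow> (u, v) \<in> E \<Longrightarrow> v \<in> D"
  shows "D = inner"
proof -
  interpret I: arc_tree inner "E \<inter> inner \<times> inner" using inner_plus_leaves_tree inner_sub by blast
  show ?thesis by (rule I.closed_eq) (use assms in auto)
qed

text \<open>
  The vertices without children when the inner vertices are rooted at \<open>r\<close>: one neighbour of each
  vertex other than \<open>r\<close> is its parent.
\<close>

definition childless :: "'a \<Rightarrow> 'a set" where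
  "childless r = {v \<in> inner. if v = r then E `` {v} \<inter> inner = {} else card (E `` {v} \<inter> inner) \<le> 1}"

end

section \<open>Interval representations from preorder numbers\<close>

lemma overlap_intervals:
  fixes a b c d :: nat
  assumes "a \<le> b" "c \<le> d"
  shows "overlap {a..b} {c..d} \<longleftrightarrow> a < c \<and> c \<le> b \<and> b < d \<or> c < a \<and> a \<le> d \<and> d < b"
proof -
  have "{a..b} \<inter> {c..d} \<noteq> {} \<longleftrightarrow> max a c \<le> min b d"
    by (auto simp: Int_atLeastAtMost)
  then show ?thesis using assms unfolding overlap_def by auto
qed

lemma overlap_comm: "overlap A B \<longleftrightarrow> overlap B A"
  unfolding overlap_def by blast

locale inner_rooted_tree = big_tree +
  fixes r :: 'a
  assumes root: "r \<in> inner"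
begin

text \<open>
  What the representation needs to know about a depth-first numbering.  For an inner vertex \<open>v\<close> the numbers used for
  the subtree of \<open>v\<close> are \<open>pre v, \<dots>, post v\<close>; the strict inequality \<open>pre v < post v\<close>
  reserves an extra number for a childless \<open>v\<close>.  The next to last condition says that a vertex
  strictly inside the range of \<open>u\<close> has its parent there too.  At \<open>r\<close>, which
  has no parent, \<open>par\<close> has a default value.
\<close>

definition preorder_numbering :: "('a \<Rightarrow> 'a) \<Rightarrow> ('a \<Rightarrow> nat) \<Rightarrow> ('a \<Rightarrow> nat) \<Rightarrow> nat \<Rightarrow> bool" where
  "preorder_numbering par pre post k \<longleftrightarrow>
     pre r = 1 \<and> inj_on pre inner \<and>
     (\<forall>v\<in>inner. 1 \<le> pre v \<and> pre v < post v \<and> post v \<le> k) \<and>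
     (\<forall>v\<in>V - {r}. (par v, v) \<in> E \<and> par v \<in> inner) \<and>
     (\<forall>v\<in>inner - {r}. pre (par v) < pre v \<and> post v \<le> post (par v)) \<and>
     (\<forall>u\<in>inner. \<forall>v. (u, v) \<in> E \<longrightarrow> v = par u \<and> u \<noteq> r \<or> par v = u \<and> v \<noteq> r) \<and>
     (\<forall>u\<in>inner. \<forall>v\<in>inner. pre u \<le> pre v \<and> pre v \<le> post u \<longrightarrow> post v \<le> post u) \<and>
     (\<forall>u\<in>inner. \<forall>v\<in>inner. pre u < pre v \<and> pre v \<le> post u \<longrightarrow> pre u \<le> pre (par v)) \<and>
     k \<le> card inner + card (childless r)"

text \<open>
  The left end is the number of the parent both for inner vertices and for leaves, the parent of a leaf being
  its neighbour; the root starts at 0.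
\<close>

definition interval_rep :: "('a \<Rightarrow> 'a) \<Rightarrow> ('a \<Rightarrow> nat) \<Rightarrow> ('a \<Rightarrow> nat) \<Rightarrow> 'a \<Rightarrow> nat set" where
  "interval_rep par pre post v =
     {(if v = r then 0 else pre (par v))..(if v \<in> inner then pre v else post (par v))}"

context
  fixes par :: "'a \<Rightarrow> 'a" and pre post :: "'a \<Rightarrow> nat" and k :: nat
  assumes num: "preorder_numbering par pre post k"
begin

lemma pre_root: "pre r = 1"
  and pre_inj: "inj_on pre inner"
  and pre_pos: "v \<in> inner \<Longrightarrow> 1 \<le> pre v"
  and pre_post: "v \<in> inner \<Longrightarrow> pre v < post v"
  and post_le: "v \<in> inner \<Longrightarrow> post v \<le> k"
  and par_arc: "v \<in> V \<Longrightarrow> v \<noteq> r \<Longrightarrow> (par v, v) \<in> E"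
  and par_inner: "v \<in> V \<Longrightarrow> v \<noteq> r \<Longrightarrow> par v \<in> inner"
  and pre_par: "v \<in> inner \<Longrightarrow> v \<noteq> r \<Longrightarrow> pre (par v) < pre v"
  and post_par: "v \<in> inner \<Longrightarrow> v \<noteq> r \<Longrightarrow> post v \<le> post (par v)"
  and arc_par: "u \<in> inner \<Longrightarrow> (u, v) \<in> E \<Longrightarrow> v = par u \<and> u \<noteq> r \<or> par v = u \<and> v \<noteq> r"
  and laminar: "u \<in> inner \<Longrightarrow> v \<in> inner \<Longrightarrow> pre u \<le> pre v \<Longrightarrow> pre v \<le> post u \<Longrightarrow> post v \<le> post u"
  and below: "u \<in> inner \<Longrightarrow> v \<in> inner \<Longrightarrow> pre u < pre v \<Longrightarrow> pre v \<le> post u \<Longrightarrow> pre u \<le> pre (par v)"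
  and numbers: "k \<le> card inner + card (childless r)"
  using num unfolding preorder_numbering_def by blast+

text \<open>
  If the intervals overlap, then that of \<open>u\<close> starts first and \<open>u\<close> lies in the range of the parent of
  \<open>v\<close>.  Unless \<open>u\<close> is that parent, the parent of \<open>u\<close> lies in the same range, so the
  interval of \<open>u\<close> cannot start first.
\<close>

lemma overlap_inner_inner:
  assumes "u \<in> inner" "v \<in> inner" "pre u < pre v"
  shows "overlap (interval_rep par pre post u) (interval_rep par pre post v) \<longleftrightarrow> par v = u"
proof -
  (* The root has the smallest number, so the larger one belongs to another vertex. *)
  have vr: "v \<noteq> r" using assms pre_root pre_pos[of u] by auto
  note pv = par_inner[of v] and pu = par_inner[of u]
  have V: "u \<in> V" "v \<in> V" using assms inner_sub by auto
  show ?thesis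
  proof (cases "u = r")
    case True
    then have "overlap (interval_rep par pre post u) (interval_rep par pre post v)
        \<longleftrightarrow> 0 < pre (par v) \<and> pre (par v) \<le> 1"
      using assms vr pre_par[of v] pre_root
      by (auto simp: interval_rep_def overlap_intervals)
    also have "\<dots> \<longleftrightarrow> pre (par v) = pre r" using pre_pos[of "par v"] pv vr V pre_root by auto
    also have "\<dots> \<longleftrightarrow> par v = r" using pre_inj pv vr V root by (auto dest: inj_onD)
    finally show ?thesis using True by simp
  next
    case False
    have "overlap (interval_rep par pre post u) (interval_rep par pre post v)
        \<longleftrightarrow> pre (par u) < pre (par v) \<and> pre (par v) \<le> pre u"
      using assms vr False pre_par[of v] pre_par[of u]
      by (auto simp: interval_rep_def overlap_intervals)
    also have "\<dots> \<longleftrightarrow> par v = u"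
    proof
      assume *: "pre (par u) < pre (par v) \<and> pre (par v) \<le> pre u"
      show "par v = u"
      proof (rule ccontr)
        assume "par v \<noteq> u"
        then have "pre (par v) < pre u" using * pre_inj pv vr V assms by (metis inj_onD le_neq_implies_less)
        moreover have "pre u \<le> post (par v)"
          using assms pre_post[of v] post_par[of v] vr by linarith
        ultimately show False using below[of "par v" u] pv vr V assms * by auto
      qed
    qed (use pre_par[of u] assms False in auto)
    finally show ?thesis .
  qed
qed

text \<open>
  The interval of \<open>w\<close> is the full range of its neighbour \<open>u\<close>, and the ends of the interval of \<open>v\<close> are the numbers
  of \<open>v\<close> and its parent (or 0).  By laminarity such a range can only separate these two if it belongs to \<open>v\<close>
  itself.
\<close>

lemma overlap_inner_leaf:
  assumes v: "v \<in> inner" and w: "w \<in> V - inner"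
  shows "overlap (interval_rep par pre post v) (interval_rep par pre post w) \<longleftrightarrow> par w = v"
proof -
  define u where "u = par w"
  have wr: "w \<noteq> r" using w root by auto
  have u: "u \<in> inner" using par_inner[of w] w wr by (auto simp: u_def)
  have V: "v \<in> V" using v inner_sub by auto
  have fw: "interval_rep par pre post w = {pre u..post u}" using w wr by (simp add: interval_rep_def u_def)
  define l where "l = (if v = r then 0 else pre (par v))"
  have fv: "interval_rep par pre post v = {l..pre v}" using v by (simp add: interval_rep_def l_def)
  have l: "l < pre v" using pre_par[OF v] pre_pos[OF v] by (auto simp: l_def)
  have iff: "overlap {l..pre v} {pre u..post u} \<longleftrightarrow>
      l < pre u \<and> pre u \<le> pre v \<and> pre v < post u \<or> pre u < l \<and> l \<le> post u \<and> post u < pre v"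
    using l pre_post[OF u] by (intro overlap_intervals) auto
  have 1: "\<not> (pre u < l \<and> l \<le> post u \<and> post u < pre v)"
  proof
    assume *: "pre u < l \<and> l \<le> post u \<and> post u < pre v"
    then have "v \<noteq> r" by (auto simp: l_def)
    then have "post (par v) \<le> post u" "pre v < post v" "post v \<le> post (par v)"
      using * laminar[OF u, of "par v"] par_inner[of v] V pre_post[OF v] post_par[OF v] by (auto simp: l_def)
    then show False using * by linarith
  qed
  have 2: "u = v" if *: "l < pre u" "pre u \<le> pre v" "pre v < post u"
  proof (rule ccontr)
    assume "u \<noteq> v"
    then have "pre u < pre v" using * pre_inj u v by (metis inj_onD le_neq_implies_less)
    moreover from this have "v \<noteq> r" using pre_root pre_pos[OF u] by auto
    ultimately show False using below[OF u v] * by (auto simp: l_def)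
  qed
  have "overlap {l..pre v} {pre u..post u} \<longleftrightarrow> u = v"
    using iff 1 2 l pre_post[OF u] by auto
  then show ?thesis using fw fv u_def by simp
qed

lemma not_overlap_leaf_leaf:
  assumes "v \<in> V - inner" "w \<in> V - inner"
  shows "\<not> overlap (interval_rep par pre post v) (interval_rep par pre post w)"
proof -
  have r: "v \<noteq> r" "w \<noteq> r" using assms root by auto
  have i: "par v \<in> inner" "par w \<in> inner" using par_inner assms r by auto
  have "\<not> overlap {pre (par v)..post (par v)} {pre (par w)..post (par w)}"
    using laminar[OF i] laminar[OF i(2,1)] pre_post[OF i(1)] pre_post[OF i(2)]
    by (subst overlap_intervals) auto
  then show ?thesis using assms r by (simp add: interval_rep_def)
qed

lemma interval_rep_correct:
  assumes "u \<in> V" "v \<in> V" "u \<noteq> v"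
  shows "(u, v) \<in> E \<longleftrightarrow> overlap (interval_rep par pre post u) (interval_rep par pre post v)"
proof -
  have ii: "(a, b) \<in> E \<longleftrightarrow> par b = a" if "a \<in> inner" "b \<in> inner" "pre a < pre b" for a b
  proof
    assume "(a, b) \<in> E"
    then show "par b = a" using arc_par[of a b] pre_par[of a] that by auto
  next
    assume "par b = a"
    moreover have "b \<noteq> r" using that pre_root pre_pos[of a] by auto
    ultimately show "(a, b) \<in> E" using par_arc[of b] that inner_sub by auto
  qed
  have il: "(a, b) \<in> E \<longleftrightarrow> par b = a" if a: "a \<in> inner" and b: "b \<in> V - inner" for a b
  proof -
    have "(par b, b) \<in> E" using par_arc[of b] b root by auto
    then show ?thesis using leaf_nbr_unique[OF b] by blast
  qed
  have ll: "(a, b) \<notin> E" if "a \<in> V - inner" "b \<in> V - inner" for a b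
    using leaf_nbr_unique[OF that(2)] that by blast
  consider "u \<in> inner" "v \<in> inner" "pre u < pre v" | "u \<in> inner" "v \<in> inner" "pre v < pre u"
    | "u \<in> inner" "v \<in> V - inner" | "u \<in> V - inner" "v \<in> inner" | "u \<in> V - inner" "v \<in> V - inner"
    using assms pre_inj by (metis Diff_iff inj_onD linorder_neqE_nat)
  then show ?thesis
  proof cases
    case 1
    then show ?thesis using ii overlap_inner_inner by simp
  next
    case 2
    then show ?thesis using ii[of v u] overlap_inner_inner[of v u] arcs_sym overlap_comm by metis
  next
    case 3
    then show ?thesis using il overlap_inner_leaf by simp
  next
    case 4
    then show ?thesis using il[of v u] overlap_inner_leaf[of v u] arcs_sym overlap_comm by metis
  next
    case 5
    then show ?thesis using ll not_overlap_leaf_leaf by simp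
  qed
qed

lemma interval_rep_size: "card (\<Union>v\<in>V. interval_rep par pre post v) \<le> 1 + card inner + card (childless r)"
proof -
  have "interval_rep par pre post v \<subseteq> {0..k}" if "v \<in> V" for v
  proof -
    have "(if v \<in> inner then pre v else post (par v)) \<le> k"
      using that pre_post[of v] post_le[of v] post_le[of "par v"] par_inner[of v] root by auto
    then show ?thesis by (auto simp: interval_rep_def)
  qed
  then have "card (\<Union>v\<in>V. interval_rep par pre post v) \<le> card {0..k}"
    by (intro card_mono) auto
  then show ?thesis using numbers by simp
qed

end

end

section \<open>Depth-first search\<close>

text \<open>
  The search has opened the vertices in \<open>D\<close>, and those on the stack \<open>st\<close> are not yet closed, the
  current vertex being the first.  The arcs in \<open>Q\<close> still have to be looked at.  A closed vertex has its
  final range.  A vertex on the stack behaves as if its range were unbounded, and the conditions on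
  it are the limits of those on closed vertices.  The last condition pays for the numbers used so
  far: one per opened vertex, and one per closed childless vertex.
\<close>

locale dfs_state = inner_rooted_tree +
  fixes par :: "'a \<Rightarrow> 'a" and pre post :: "'a \<Rightarrow> nat" and k :: nat
    and st :: "'a list" and D :: "'a set" and Q :: "('a \<times> 'a) set"
  assumes stack_opened: "set st \<subseteq> D"
    and opened_inner: "D \<subseteq> inner"
    and root_opened: "r \<in> D"
    and pre_root: "pre r = 1"
    and pre_inj: "inj_on pre D"
    and pre_pos: "v \<in> D \<Longrightarrow> 1 \<le> pre v"
    and pre_le: "v \<in> D \<Longrightarrow> pre v \<le> k"
    and pending: "Q \<subseteq> E"
    and unopened_pending: "v \<in> inner \<Longrightarrow> v \<notin> D \<Longrightarrow> (v, y) \<in> E \<Longrightarrow> (v, y) \<in> Q"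
    and closed_explored: "v \<in> D \<Longrightarrow> v \<notin> set st \<Longrightarrow> (v, y) \<notin> Q"
    and stack_sorted: "sorted_wrt (\<lambda>a b. pre b < pre a) st"
    and stack_parents: "successively (\<lambda>a b. a \<noteq> r \<and> par a = b) st"
    and stack_root: "st \<noteq> [] \<Longrightarrow> last st = r"
    and explored: "v \<in> D \<Longrightarrow> (v, y) \<in> E \<Longrightarrow> (v, y) \<notin> Q \<Longrightarrow>
        y = par v \<and> v \<noteq> r \<or> par y = v \<and> y \<noteq> r \<and> (y \<in> inner \<longrightarrow> y \<in> D)"
    and parent: "v \<in> D \<Longrightarrow> v \<noteq> r \<Longrightarrow>
        par v \<in> D \<and> (par v, v) \<in> E \<and> (par v, v) \<notin> Q \<and> pre (par v) < pre v"
    and closed_parent: "v \<in> D \<Longrightarrow> v \<noteq> r \<Longrightarrow> par v \<notin> set st \<Longrightarrow> v \<notin> set st \<and> post v \<le> post (par v)"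
    and closed_post: "v \<in> D \<Longrightarrow> v \<notin> set st \<Longrightarrow> pre v < post v \<and> post v \<le> k"
    and closed_laminar: "u \<in> D \<Longrightarrow> u \<notin> set st \<Longrightarrow> v \<in> D \<Longrightarrow> pre u \<le> pre v \<Longrightarrow> pre v \<le> post u \<Longrightarrow>
        v \<notin> set st \<and> post v \<le> post u"
    and closed_below: "u \<in> D \<Longrightarrow> u \<notin> set st \<Longrightarrow> v \<in> D \<Longrightarrow> pre u < pre v \<Longrightarrow> pre v \<le> post u \<Longrightarrow>
        pre u \<le> pre (par v)"
    and stack_below: "u \<in> set st \<Longrightarrow> v \<in> D \<Longrightarrow> pre u < pre v \<Longrightarrow> pre u \<le> pre (par v)"
    and numbers_used: "k \<le> card D + card (childless r \<inter> (D - set st))"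
begin

lemma finite_opened: "finite D"
  using opened_inner finite_inner finite_subset by blast

text \<open>
  The arcs between opened vertices and their parents already exhaust the sparsity bound for \<open>D\<close>, so an
  arc not among them cannot lead back into \<open>D\<close>.
\<close>

lemma new_vertex:
  assumes v: "v \<in> D" and y: "(v, y) \<in> Q" and np: "v = r \<or> y \<noteq> par v"
  shows "y \<notin> D"
proof
  assume yD: "y \<in> D"
  let ?A = "(\<lambda>z. (z, par z)) ` (D - {r})" and ?B = "(\<lambda>z. (par z, z)) ` (D - {r})" and ?C = "{(v, y), (y, v)}"
  have vy: "(v, y) \<in> E" "v \<noteq> y" using y pending arcD by blast+
  have npy: "y = r \<or> v \<noteq> par y" using parent[OF yD] y by auto
  have "?A \<union> ?B \<union> ?C \<subseteq> E \<inter> D \<times> D"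
    using parent v yD vy arcs_sym by auto
  then have "card (?A \<union> ?B \<union> ?C) \<le> card (E \<inter> D \<times> D)" using finite_arcs by (intro card_mono) auto
  moreover have "card (?A \<union> ?B \<union> ?C) = 2 * (card D - 1) + 2"
  proof -
    have "?A \<inter> ?B = {}"
    proof (rule ccontr)
      assume "?A \<inter> ?B \<noteq> {}"
      then obtain z z' where "z \<in> D - {r}" "z' \<in> D - {r}" "z = par z'" "par z = z'" by auto
      then show False using parent[of z] parent[of z'] by auto
    qed
    moreover have "(?A \<union> ?B) \<inter> ?C = {}" using np npy by auto
    moreover have "card ?A = card D - 1" "card ?B = card D - 1"
      using root_opened finite_opened by (subst card_image; auto simp: inj_on_def)+
    moreover have "card ?C = 2" using vy by auto
    moreover have "finite ?A" "finite ?B" "finite ?C" using finite_opened by auto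
    ultimately show ?thesis
      using card_Un_disjoint[of "?A \<union> ?B" ?C] card_Un_disjoint[of ?A ?B] by simp
  qed
  moreover have "card D > 0" using root_opened finite_opened by (auto simp: card_gt_0_iff)
  moreover have "card (E \<inter> D \<times> D) + 2 \<le> 2 * card D"
    using opened_inner inner_sub root_opened by (intro sparse) auto
  ultimately show False by linarith
qed

lemma step_back:
  assumes "v \<noteq> r" "v \<in> D" "y = par v"
  shows "dfs_state V E r par pre post k st D (Q - {(v, y)})"
proof unfold_locales
  fix u z assume u: "u \<in> inner" "u \<notin> D" "(u, z) \<in> E"
  then show "(u, z) \<in> Q - {(v, y)}" using unopened_pending assms by blast
next
  fix u z assume u: "u \<in> D" "(u, z) \<in> E" "(u, z) \<notin> Q - {(v, y)}"
  then show "z = par u \<and> u \<noteq> r \<or> par z = u \<and> z \<noteq> r \<and> (z \<in> inner \<longrightarrow> z \<in> D)"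
    using explored[OF u(1,2)] assms by auto
next
  show "Q - {(v, y)} \<subseteq> E" using pending by auto
next
  show "\<And>u. u \<in> D \<Longrightarrow> u \<noteq> r \<Longrightarrow>
        par u \<in> D \<and> (par u, u) \<in> E \<and> (par u, u) \<notin> Q - {(v, y)} \<and> pre (par u) < pre u" using parent by blast
next
  show "\<And>v' y'. v' \<in> D \<Longrightarrow> v' \<notin> set st \<Longrightarrow> (v', y') \<notin> Q - {(v, y)}" using closed_explored by blast
qed (fact stack_opened opened_inner root_opened pre_root pre_inj pre_pos pre_le stack_sorted
    stack_parents stack_root closed_parent closed_post closed_laminar closed_below stack_below numbers_used)+

lemma step_leaf:
  assumes v: "v \<in> D" and y: "(v, y) \<in> Q" "y \<notin> inner"
  shows "dfs_state V E r (par(y := v)) pre post k st D (Q - {(v, y)})"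
proof -
  have yD: "y \<notin> D" "y \<noteq> r" using y opened_inner root by auto
  have par: "(par(y := v)) u = par u" if "u \<in> D" for u using that yD by auto
  have vy: "(v, y) \<in> E" using y pending by blast
  then have yl: "y \<in> V - inner" using y arcD by blast
  have only: "u = v" if "(u, y) \<in> E" for u using leaf_nbr_unique[OF yl vy that] by simp
  show ?thesis
  proof unfold_locales
    fix u z assume u: "u \<in> inner" "u \<notin> D" "(u, z) \<in> E"
    then show "(u, z) \<in> Q - {(v, y)}" using unopened_pending v by blast
  next
    fix u z assume u: "u \<in> D" "(u, z) \<in> E" "(u, z) \<notin> Q - {(v, y)}"
    show "z = (par(y := v)) u \<and> u \<noteq> r \<or> (par(y := v)) z = u \<and> z \<noteq> r \<and> (z \<in> inner \<longrightarrow> z \<in> D)"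
    proof (cases "z = y")
      case True
      then show ?thesis using only u yD y by auto
    next
      case False
      then show ?thesis using explored[OF u(1,2)] u par by auto
    qed
  next
    show "Q - {(v, y)} \<subseteq> E" using pending by auto
  next
    fix u assume u: "u \<in> D" "u \<noteq> r"
    then show "(par(y := v)) u \<in> D \<and> ((par(y := v)) u, u) \<in> E \<and> ((par(y := v)) u, u) \<notin> Q - {(v, y)}
        \<and> pre ((par(y := v)) u) < pre u" using parent par by auto
  next
    show "\<And>v' y'. v' \<in> D \<Longrightarrow> v' \<notin> set st \<Longrightarrow> (v', y') \<notin> Q - {(v, y)}" using closed_explored by blast
  next
    show "successively (\<lambda>a b. a \<noteq> r \<and> (par(y := v)) a = b) st"
      using stack_parents by (rule successively_mono) (use yD stack_opened in auto)
  next
    fix u z assume "u \<in> D" "u \<notin> set st" "z \<in> D" "pre u < pre z" "pre z \<le> post u"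
    then show "pre u \<le> pre ((par(y := v)) z)" using closed_below[of u z] par[of z] by simp
  next
    fix u z assume "u \<in> set st" "z \<in> D" "pre u < pre z"
    then show "pre u \<le> pre ((par(y := v)) z)" using stack_below[of u z] par[of z] by simp
  next
    fix u assume "u \<in> D" "u \<noteq> r" "(par(y := v)) u \<notin> set st"
    then show "u \<notin> set st \<and> post u \<le> post ((par(y := v)) u)" using closed_parent[of u] par[of u] by simp
  qed (fact stack_opened opened_inner root_opened pre_root pre_inj pre_pos pre_le stack_sorted
      stack_root closed_post closed_laminar numbers_used)+
qed

lemma step_open:
  assumes st: "st = v # rest" and y: "(v, y) \<in> Q" "y \<in> inner" and np: "v = r \<or> y \<noteq> par v"
  shows "dfs_state V E r (par(y := v)) (pre(y := k + 1)) post (k + 1) (y # st) (insert y D) (Q - {(v, y)})"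
proof -
  have v: "v \<in> D" "v \<in> set st" using st stack_opened by auto
  have yD: "y \<notin> D" using new_vertex v y np by blast
  then have yr: "y \<noteq> r" "y \<notin> set st" using root_opened stack_opened by auto
  let ?par = "par(y := v)" and ?pre = "pre(y := k + 1)"
  have par: "?par u = par u" if "u \<in> D" for u using that yD by auto
  have pre: "?pre u = pre u" if "u \<in> D" for u using that yD by auto
  have prepar: "?pre (par u) = pre (par u)" if "u \<in> D" "u \<noteq> r" for u using parent[OF that] pre by auto
  have vy: "(v, y) \<in> E" using y pending by blast
  have top: "pre u \<le> pre v" if "u \<in> set st" for u using stack_sorted st that by auto
  show ?thesis
  proof unfold_locales
    show "inj_on ?pre (insert y D)"
    proof -
      have new: "k + 1 \<notin> pre ` D" using pre_le by fastforce
      have "inj_on ?pre D" using pre_inj new by (rule inj_on_fun_updI)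
      moreover have "?pre ` D = pre ` D" using yD by auto
      ultimately show ?thesis using new yD by simp
    qed
  next
    fix u assume "u \<in> insert y D"
    then show "1 \<le> ?pre u" "?pre u \<le> k + 1" using pre_pos[of u] pre_le[of u] by auto
  next
    fix u z assume "u \<in> inner" "u \<notin> insert y D" "(u, z) \<in> E"
    then show "(u, z) \<in> Q - {(v, y)}" using unopened_pending v by blast
  next
    fix u z assume u: "u \<in> insert y D" "(u, z) \<in> E" "(u, z) \<notin> Q - {(v, y)}"
    show "z = ?par u \<and> u \<noteq> r \<or> ?par z = u \<and> z \<noteq> r \<and> (z \<in> inner \<longrightarrow> z \<in> insert y D)"
    proof (cases "u = y")
      case True
      then show ?thesis using unopened_pending[OF y(2) yD] u v yD by blast
    next
      case False
      show ?thesis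
      proof (cases "(u, z) = (v, y)")
        case True
        then show ?thesis using yr by auto
      next
        case neq: False
        then have *: "z = par u \<and> u \<noteq> r \<or> par z = u \<and> z \<noteq> r \<and> (z \<in> inner \<longrightarrow> z \<in> D)"
          using explored[of u z] u False by blast
        show ?thesis
        proof (cases "z = y")
          case True
          then show ?thesis using * parent[of u] yD y u False by auto
        next
          case False
          then show ?thesis using * par u \<open>u \<noteq> y\<close> by auto
        qed
      qed
    qed
  next
    fix u assume u: "u \<in> insert y D" "u \<noteq> r"
    show "?par u \<in> insert y D \<and> (?par u, u) \<in> E \<and> (?par u, u) \<notin> Q - {(v, y)} \<and> ?pre (?par u) < ?pre u"
    proof (cases "u = y")
      case True
      then show ?thesis using v vy yD pre_le[of v] by auto
    next
      case False
      then have "u \<in> D" using u by blast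
      then show ?thesis using parent[OF _ u(2)] par prepar[OF _ u(2)] pre by auto
    qed
  next
    show "successively (\<lambda>a b. a \<noteq> r \<and> ?par a = b) (y # st)"
    proof -
      have "successively (\<lambda>a b. a \<noteq> r \<and> ?par a = b) st"
        using stack_parents by (rule successively_mono) (use yD stack_opened in auto)
      then show ?thesis using st yr by simp
    qed
  next
    show "sorted_wrt (\<lambda>a b. ?pre b < ?pre a) (y # st)"
    proof -
      have "sorted_wrt (\<lambda>a b. ?pre b < ?pre a) st"
        using stack_sorted by (rule sorted_wrt_mono_rel[rotated]) (use yD stack_opened in auto)
      moreover have "?pre u < ?pre y" if "u \<in> set st" for u
        using pre_le[of u] pre[of u] stack_opened that by (auto simp: le_imp_less_Suc)
      ultimately show ?thesis by simp
    qed
  next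
    show "last (y # st) = r" using stack_root st by simp
  next
    fix u assume u: "u \<in> insert y D" "u \<noteq> r" "?par u \<notin> set (y # st)"
    then have "u \<in> D" using v by auto
    then show "u \<notin> set (y # st) \<and> post u \<le> post (?par u)"
      using closed_parent[of u] u par yD by auto
  next
    fix u assume "u \<in> insert y D" "u \<notin> set (y # st)"
    then show "?pre u < post u \<and> post u \<le> k + 1" using closed_post[of u] by auto
  next
    fix u z assume u: "u \<in> insert y D" "u \<notin> set (y # st)" "z \<in> insert y D" "?pre u \<le> ?pre z" "?pre z \<le> post u"
    then have "u \<in> D" "u \<notin> set st" by auto
    moreover have "z \<noteq> y" using u closed_post[of u] by auto
    ultimately show "z \<notin> set (y # st) \<and> post z \<le> post u"
      using closed_laminar[of u z] u yD by auto
  next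
    fix u z assume u: "u \<in> insert y D" "u \<notin> set (y # st)" "z \<in> insert y D" "?pre u < ?pre z" "?pre z \<le> post u"
    then have uD: "u \<in> D" "u \<notin> set st" "u \<noteq> y" by auto
    have zy: "z \<noteq> y" using u closed_post[of u] by auto
    then have z: "z \<in> D" using u by blast
    have "z \<noteq> r" using u uD zy pre_root pre_pos[of u] by auto
    then show "?pre u \<le> ?pre (?par z)"
      using closed_below[of u z] u uD zy z prepar[of z] by auto
  next
    fix u z assume u: "u \<in> set (y # st)" "z \<in> insert y D" "?pre u < ?pre z"
    have "u \<noteq> y" using u pre_le[of z] by (auto split: if_splits)
    then have uD: "u \<in> set st" "u \<in> D" using u stack_opened by auto
    show "?pre u \<le> ?pre (?par z)"
    proof (cases "z = y")
      case True
      then show ?thesis using top[OF uD(1)] v yD \<open>u \<noteq> y\<close> by auto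
    next
      case False
      then have z: "z \<in> D" "z \<noteq> r" using u uD \<open>u \<noteq> y\<close> pre_root pre_pos[of u] by auto
      then show ?thesis using stack_below[of u z] u uD False \<open>u \<noteq> y\<close> prepar[of z] by auto
    qed
  next
    have "insert y D - set (y # st) = D - set st" using yD by auto
    then show "k + 1 \<le> card (insert y D) + card (childless r \<inter> (insert y D - set (y # st)))"
      using numbers_used yD finite_opened by simp
  next
    show "set (y # st) \<subseteq> insert y D" using stack_opened by auto
    show "insert y D \<subseteq> inner" using opened_inner y by auto
    show "r \<in> insert y D" "?pre r = 1" using root_opened pre_root yr by auto
    show "Q - {(v, y)} \<subseteq> E" using pending by auto
    show "\<And>a b. a \<in> insert y D \<Longrightarrow> a \<notin> set (y # st) \<Longrightarrow> (a, b) \<notin> Q - {(v, y)}"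
      using closed_explored by auto
  qed
qed

text \<open>
  If no number has been given out since \<open>v\<close> was opened, then \<open>v\<close> has no children and receives an extra
  number.
\<close>

lemma step_close:
  assumes st: "st = v # rest" and no_arc: "\<And>y. (v, y) \<notin> Q"
    and k': "k' = (if pre v = k then k + 1 else k)"
  shows "dfs_state V E r par pre (post(v := k')) k' rest D Q"
proof -
  have v: "v \<in> D" "v \<in> set st" using st stack_opened by auto
  have vrest: "v \<notin> set rest" and rest: "pre u < pre v" if "u \<in> set rest" for u
    using stack_sorted st that by auto
  have nrest: "v \<notin> set rest" using rest by blast
  have set_st: "set st = insert v (set rest)" using st by simp
  let ?post = "post(v := k')"
  have kk: "k \<le> k'" using k' by simp
  show ?thesis
  proof unfold_locales
    show "set rest \<subseteq> D" using stack_opened st by auto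
    show "\<And>u. u \<in> D \<Longrightarrow> pre u \<le> k'" using pre_le kk le_trans by blast
    show "\<And>u y. u \<in> D \<Longrightarrow> u \<notin> set rest \<Longrightarrow> (u, y) \<notin> Q" using closed_explored no_arc st by auto
    show "sorted_wrt (\<lambda>a b. pre b < pre a) rest" using stack_sorted st by simp
    show "successively (\<lambda>a b. a \<noteq> r \<and> par a = b) rest" using stack_parents st by (cases rest) auto
    show "rest \<noteq> [] \<Longrightarrow> last rest = r" using stack_root st by simp
    fix u assume u: "u \<in> D" "u \<noteq> r" "par u \<notin> set rest"
    show "u \<notin> set rest \<and> ?post u \<le> ?post (par u)"
    proof (cases "par u = v")
      case True
      then have pu: "pre v < pre u" using parent[OF u(1,2)] by simp
      then have "u \<notin> set st" using rest set_st by (metis insertE less_asym)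
      then show ?thesis using closed_post[OF u(1)] True set_st pu kk by auto
    next
      case False
      then have "u \<notin> set st \<and> post u \<le> post (par u)" using closed_parent[OF u(1,2)] u set_st by auto
      then show ?thesis using set_st False by auto
    qed
  next
    fix u assume u: "u \<in> D" "u \<notin> set rest"
    show "pre u < ?post u \<and> ?post u \<le> k'"
      using closed_post[of u] u pre_le[of u] k' set_st by (cases "u = v") auto
  next
    fix u z assume u: "u \<in> D" "u \<notin> set rest" "z \<in> D" "pre u \<le> pre z" "pre z \<le> ?post u"
    show "z \<notin> set rest \<and> ?post z \<le> ?post u"
    proof (cases "u = v")
      case True
      then have "z \<notin> set rest" using u rest by fastforce
      moreover have "?post z \<le> k'"
      proof (cases "z = v")
        case False
        then have "z \<notin> set st" using set_st \<open>z \<notin> set rest\<close> by simp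
        then have "post z \<le> k" using closed_post[OF u(3)] by simp
        then show ?thesis using False kk by simp
      qed simp
      ultimately show ?thesis using True by simp
    next
      case False
      then have "z \<notin> set st \<and> post z \<le> post u" using closed_laminar[of u z] u set_st by auto
      then show ?thesis using set_st False by auto
    qed
  next
    fix u z assume u: "u \<in> D" "u \<notin> set rest" "z \<in> D" "pre u < pre z" "pre z \<le> ?post u"
    show "pre u \<le> pre (par z)"
      using closed_below[of u z] stack_below[of u z] u v set_st by (cases "u = v") auto
  next
    fix u z assume "u \<in> set rest" "z \<in> D" "pre u < pre z"
    then show "pre u \<le> pre (par z)" using stack_below set_st by auto
  next
    have split: "D - set rest = insert v (D - set st)" using v set_st nrest by auto
    have fin: "finite (childless r \<inter> (D - set rest))" using finite_opened by auto
    show "k' \<le> card D + card (childless r \<inter> (D - set rest))"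
    proof (cases "pre v = k")
      case True
      have nbr: "y = par v \<and> v \<noteq> r" if "(v, y) \<in> E" "y \<in> inner" for y
      proof (rule ccontr)
        assume "\<not> ?thesis"
        then have "par y = v" "y \<noteq> r" "y \<in> D" using explored[OF v(1) that(1) no_arc] that by auto
        then show False using parent[of y] pre_le[of y] True by auto
      qed
      have "E `` {v} \<inter> inner \<subseteq> {par v}" "v = r \<Longrightarrow> E `` {v} \<inter> inner = {}" using nbr by auto
      moreover have "card (E `` {v} \<inter> inner) \<le> card {par v}"
        by (intro card_mono) (use calculation in auto)
      ultimately have "v \<in> childless r" using v opened_inner unfolding childless_def by auto
      then have "childless r \<inter> (D - set rest) = insert v (childless r \<inter> (D - set st))" using split by auto
      then have "card (childless r \<inter> (D - set rest)) = Suc (card (childless r \<inter> (D - set st)))"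
        using finite_opened v by simp
      then show ?thesis using numbers_used True k' by simp
    next
      case False
      have "card (childless r \<inter> (D - set st)) \<le> card (childless r \<inter> (D - set rest))"
        using split fin by (intro card_mono) auto
      then show ?thesis using numbers_used False k' by simp
    qed
  qed (fact opened_inner root_opened pre_root pre_inj pre_pos pending unopened_pending explored parent)+
qed

lemma finished:
  assumes "st = []"
  shows "preorder_numbering par pre post k"
proof -
  have D: "D = inner"
  proof (rule inner_closed_eq[OF opened_inner])
    fix u v assume "u \<in> D" "v \<in> inner" "(u, v) \<in> E"
    then show "v \<in> D" using explored[of u v] closed_explored[of u v] parent[of u] assms by auto
  qed (use root_opened in auto)
  have exp: "v = par u \<and> u \<noteq> r \<or> par v = u \<and> v \<noteq> r" if "u \<in> inner" "(u, v) \<in> E" for u v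
    using explored[of u v] closed_explored[of u v] that assms D by auto
  have leaf: "(par w, w) \<in> E \<and> par w \<in> inner" if w: "w \<in> V" "w \<noteq> r" for w
  proof (cases "w \<in> inner")
    case True
    then show ?thesis using parent[of w] D w by auto
  next
    case False
    obtain u where u: "u \<in> inner" "E `` {w} = {u}" using leaf_nbr w False by blast
    then have uw: "(u, w) \<in> E" using arcs_sym by blast
    then have "par w = u" using exp[OF u(1) uw] parent[of u] u False D by auto
    then show ?thesis using u uw by simp
  qed
  show ?thesis unfolding preorder_numbering_def
  proof (intro conjI ballI allI impI)
    show "k \<le> card inner + card (childless r)"
    proof -
      have "childless r \<inter> (D - set st) = childless r" using D assms by (auto simp: childless_def)
      then show ?thesis using numbers_used D by simp
    qed
  qed (use pre_root pre_inj pre_pos closed_post leaf parent closed_parent exp closed_laminar closed_below D assms in auto)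
qed

end

context inner_rooted_tree
begin

lemma dfs_init:
  assumes "pre r = 1"
  shows "dfs_state V E r par pre post 1 [r] {r} E"
  by unfold_locales (use assms root in simp_all)

lemma dfs_completes:
  assumes "dfs_state V E r par pre post k st D Q"
  shows "\<exists>par pre post k. preorder_numbering par pre post k"
  using assms
proof (induction "card Q + card (inner - (D - set st))" arbitrary: par pre post k st D Q rule: less_induct)
  case less
  interpret dfs_state V E r par pre post k st D Q by fact
  have finQ: "finite Q" by (rule finite_subset[OF pending finite_arcs])
  show ?case
  proof (cases st)
    case Nil
    then show ?thesis using finished by blast
  next
    case (Cons v rest)
    then have v: "v \<in> D" using stack_opened by auto
    show ?thesis
    proof (cases "\<exists>y. (v, y) \<in> Q")
      case True
      then obtain y where y: "(v, y) \<in> Q" by blast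
      have dec: "card (Q - {(v, y)}) < card Q" using y finQ by (rule card_Diff1_less[rotated])
      consider "v \<noteq> r" "y = par v" | "y \<notin> inner" | "y \<in> inner" "v = r \<or> y \<noteq> par v" by blast
      then show ?thesis
      proof cases
        case 1
        show ?thesis using less.hyps[OF _ step_back[OF 1(1) v 1(2)]] dec by simp
      next
        case 2
        show ?thesis using less.hyps[OF _ step_leaf[OF v y 2]] dec by simp
      next
        case 3
        have "y \<notin> D" using new_vertex v y 3 by blast
        then have "insert y D - set (y # st) = D - set st" by auto
        then show ?thesis using less.hyps[OF _ step_open[OF Cons y 3]] dec by simp
      qed
    next
      case False
      have "v \<notin> set rest" using stack_sorted Cons by auto
      then have "card (inner - (D - set rest)) < card (inner - (D - set st))"
        using Cons v opened_inner finite_inner by (intro psubset_card_mono) auto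
      then show ?thesis using less.hyps[OF _ step_close[OF Cons _ refl]] False by simp
    qed
  qed
qed

lemma preorder_numbering_exists: "\<exists>par pre post k. preorder_numbering par pre post k"
  using dfs_completes[OF dfs_init[of "\<lambda>_. 1"]] by simp

end

section \<open>A skeleton of the size of the interval representation\<close>

text \<open>
  The skeleton consists of the inner vertices, a leaf \<open>w0\<close> at the root and a further leaf at each childless
  vertex.  The leaf \<open>w0\<close> corresponds to the number 0 of the representation, and the leaves at
  childless vertices correspond to their extra numbers.
\<close>

lemma (in inner_rooted_tree) skeletal_subtree_exists:
  assumes root_end: "card (E `` {r} \<inter> inner) \<le> 1"
  shows "\<exists>A. inner \<subseteq> A \<and> A \<subseteq> V \<and> skeletal (E \<inter> A \<times> A)
    \<and> card A = 1 + card inner + card (childless r)"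
proof -
  have deg: "2 \<le> card (E `` {v})" if "v \<in> inner" for v using that by (simp add: inner_def)
  have leaf_left: "E `` {v} - inner \<noteq> {}" if v: "v \<in> inner" "card (E `` {v} \<inter> inner) \<le> 1" for v
  proof
    assume "E `` {v} - inner = {}"
    then have "E `` {v} \<inter> inner = E `` {v}" by blast
    then show False using deg v by fastforce
  qed
  have ch_inner: "childless r \<subseteq> inner" by (auto simp: childless_def)
  obtain w0 where w0: "(r, w0) \<in> E" "w0 \<notin> inner" using leaf_left[OF root root_end] by blast
  have leafV: "w \<in> V - inner" if "(v, w) \<in> E" "w \<notin> inner" for v w using that arcD by blast
  have nbr: "u = v" if "(v, w) \<in> E" "w \<notin> inner" "(u, w) \<in> E" for u v w
    using leaf_nbr_unique(1)[OF leafV[OF that(1,2)] that(3,1)] .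
  have "\<exists>w. (v, w) \<in> E \<and> w \<notin> inner \<and> w \<noteq> w0" if v: "v \<in> childless r" for v
  proof (cases "v = r")
    case True
    then have "E `` {r} \<inter> inner = {}" using v by (auto simp: childless_def)
    moreover have "\<not> E `` {r} \<subseteq> {w0}"
    proof
      assume "E `` {r} \<subseteq> {w0}"
      then have "card (E `` {r}) \<le> card {w0}" by (intro card_mono) auto
      then show False using deg[OF root] by simp
    qed
    ultimately show ?thesis using True by blast
  next
    case False
    then have "card (E `` {v} \<inter> inner) \<le> 1" using v by (auto simp: childless_def)
    then obtain w where w: "(v, w) \<in> E" "w \<notin> inner" using leaf_left[of v] ch_inner v by blast
    then have "w \<noteq> w0" using nbr[OF w0] False by blast
    then show ?thesis using w by blast
  qed
  then obtain l where l: "\<And>v. v \<in> childless r \<Longrightarrow> (v, l v) \<in> E \<and> l v \<notin> inner \<and> l v \<noteq> w0" by metis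
  define A where "A = inner \<union> insert w0 (l ` childless r)"
  let ?E = "E \<inter> A \<times> A"
  have fin: "finite (childless r)" using ch_inner finite_inner finite_subset by blast
  have "card A = card inner + card (insert w0 (l ` childless r))"
    unfolding A_def using finite_inner fin w0 l by (intro card_Un_disjoint) auto
  moreover have "card (insert w0 (l ` childless r)) = 1 + card (l ` childless r)"
    using fin l by (subst card_insert_disjoint) auto
  moreover have "inj_on l (childless r)"
  proof (rule inj_onI)
    fix u v assume "u \<in> childless r" "v \<in> childless r" "l u = l v"
    then show "u = v" using nbr[of v "l v" u] l[of u] l[of v] by simp
  qed
  ultimately have card_A: "card A = 1 + card inner + card (childless r)" by (simp add: card_image)
  have AV: "A \<subseteq> V" unfolding A_def using inner_sub w0 l arcD by blast
  have nbrs: "?E `` {v} = (E `` {v} \<inter> inner) \<union> ((if v = r then {w0} else {}) \<union> (if v \<in> childless r then {l v} else {}))"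
    (is "_ = ?R") if v: "v \<in> inner" for v
  proof
    show "?E `` {v} \<subseteq> ?R"
    proof
      fix y assume "y \<in> ?E `` {v}"
      then have y: "(v, y) \<in> E" "y \<in> A" by auto
      consider "y \<in> inner" | "y = w0" | u where "u \<in> childless r" "y = l u" using y by (auto simp: A_def)
      then show "y \<in> ?R"
      proof cases
        case 1
        then show ?thesis using y by simp
      next
        case 2
        then show ?thesis using nbr[OF w0] y by auto
      next
        case 3
        then have "u = v" using nbr[of v y u] y l[of u] by auto
        then show ?thesis using 3 by simp
      qed
    qed
    show "?R \<subseteq> ?E `` {v}" using v w0 l[of v] by (auto simp: A_def split: if_splits)
  qed
  have degA: "2 \<le> card (?E `` {v}) \<and> (v = r \<or> v \<in> childless r \<longrightarrow> card (?E `` {v}) = 2)" if v: "v \<in> inner" for v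
  proof -
    let ?a = "card (E `` {v} \<inter> inner)"
    have fa: "finite (E `` {v} \<inter> inner)" using finite_inner by blast
    have "card (?E `` {v}) = ?a + card ((if v = r then {w0} else {}) \<union> (if v \<in> childless r then {l v} else {}))"
      unfolding nbrs[OF v] using fa w0 l[of v] by (intro card_Un_disjoint) auto
    also have "card ((if v = r then {w0} else {}) \<union> (if v \<in> childless r then {l v} else {}))
        = (if v = r then 1 else 0) + (if v \<in> childless r then 1 else 0)"
      using l[of v] by auto
    finally have c: "card (?E `` {v}) = ?a + ((if v = r then 1 else 0) + (if v \<in> childless r then 1 else 0))" .
    show ?thesis
    proof (cases "v = r")
      case True
      then have "v \<in> childless r \<longleftrightarrow> ?a = 0" using v fa by (auto simp: childless_def)
      then show ?thesis using c root_end True by auto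
    next
      case False
      then have ch: "v \<in> childless r \<longleftrightarrow> ?a \<le> 1" using v by (auto simp: childless_def)
      have "?a \<noteq> 0"
      proof
        assume "?a = 0"
        then have "E `` {v} \<inter> inner = {}" using fa by simp
        then have "{v} = inner" using v by (intro inner_closed_eq) auto
        then show False using root False by auto
      qed
      then show ?thesis using c ch False by auto
    qed
  qed
  have "skeletal ?E" unfolding skeletal_def
  proof (intro allI impI, elim conjE)
    fix w u assume w: "card (?E `` {w}) = 1" and wu: "(w, u) \<in> ?E"
    have "w \<notin> inner" using degA[of w] w by auto
    then consider "w = w0" | v where "v \<in> childless r" "w = l v" using wu by (auto simp: A_def)
    then show "card (?E `` {u}) = 2"
    proof cases
      case 1
      then have "u = r" using nbr[OF w0, of u] wu arcs_sym by blast
      then show ?thesis using degA[OF root] by simp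
    next
      case 2
      then have "u = v" using nbr[of v w u] l[of v] wu arcs_sym by blast
      then show ?thesis using degA[of v] ch_inner 2 by auto
    qed
  qed
  then show ?thesis using card_A AV by (intro exI[of _ A]) (auto simp: A_def)
qed

section \<open>The overlap number\<close>

locale end_rooted_graph = inner_rooted_tree "pverts T" "parcs T" r for T :: "'a pair_pre_digraph" and r +
  assumes tree: "undirected_tree T"
    and root_end: "card (parcs T `` {r} \<inter> inner) \<le> 1"
begin

definition optimum :: nat where
  "optimum = 1 + card inner + card (childless r)"

lemma optimal_skeleton_exists:
  "\<exists>S. skeleton S \<and> subgraph (with_proj S) (with_proj T) \<and> card (pverts S) = optimum"
proof -
  obtain A where A: "inner \<subseteq> A" "A \<subseteq> pverts T" "skeletal (parcs T \<inter> A \<times> A)" "card A = optimum"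
    using skeletal_subtree_exists[OF root_end] unfolding optimum_def by blast
  let ?S = "\<lparr>pverts = A, parcs = parcs T \<inter> A \<times> A\<rparr>"
  have ne: "A \<noteq> {}" using A(1) root by auto
  have "undirected_tree ?S" "subgraph (with_proj ?S) (with_proj T)"
    using undirected_tree_induced[OF tree inner_plus_leaves_tree[OF A(1,2)] A(2) ne] by auto
  moreover from this have "skeleton ?S" using A(3) unfolding skeleton_def skeletal_def leaf_def degree_eq by auto
  ultimately show ?thesis using A(4) by (intro exI[of _ ?S]) auto
qed

lemma optimum_ge_3: "3 \<le> optimum"
proof -
  have "childless r \<noteq> {} \<or> 2 \<le> card inner"
  proof (rule ccontr)
    assume no: "\<not> ?thesis"
    have "card inner \<noteq> 0" using root finite_inner by auto
    then have "card inner = 1" using no by simp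
    then obtain x where "inner = {x}" by (rule card_1_singletonE)
    then have "inner = {r}" using root by simp
    then have "r \<in> childless r" using arcs_irrefl unfolding childless_def by auto
    then show False using no by blast
  qed
  moreover have "card inner \<noteq> 0" using root finite_inner by auto
  moreover have "finite (childless r)" using finite_inner unfolding childless_def by auto
  then have "childless r \<noteq> {} \<longleftrightarrow> card (childless r) \<noteq> 0" by simp
  ultimately show ?thesis unfolding optimum_def by linarith
qed

lemma rep_size_ge:
  assumes "finite_overlap_rep T f"
  shows "optimum \<le> rep_size T f"
proof -
  obtain S where "skeleton S" "subgraph (with_proj S) (with_proj T)" "card (pverts S) = optimum"
    using optimal_skeleton_exists by blast
  then show ?thesis using skeleton_lower_bound[OF tree _ _ _ assms, of S] optimum_ge_3 by simp
qed

text \<open>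
  Every representation has at least the size of the skeleton just found, so one of that size is optimal.
\<close>

lemma optimal_repI:
  assumes "finite_overlap_rep T (f :: 'a \<Rightarrow> nat set)" "rep_size T f \<le> optimum"
  shows "optimal_overlap_rep T f" "overlap_number T = optimum"
proof -
  let ?P = "\<lambda>k. \<exists>f :: 'a \<Rightarrow> nat set. finite_overlap_rep T f \<and> rep_size T f = k"
  have f: "rep_size T f = optimum" using rep_size_ge[OF assms(1)] assms(2) by simp
  have "?P (overlap_number T)"
    unfolding overlap_number_def by (rule LeastI[of ?P "rep_size T f"]) (use assms in blast)
  then have "optimum \<le> overlap_number T" using rep_size_ge by metis
  moreover have "overlap_number T \<le> rep_size T f"
    unfolding overlap_number_def by (rule Least_le) (use assms in blast)
  ultimately show *: "overlap_number T = optimum" using f by simp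
  show "optimal_overlap_rep T f" using assms f * by (simp add: optimal_overlap_rep_def)
qed

lemma optimal_interval_rep:
  assumes "preorder_numbering par pre post k"
    and eq: "\<And>v. v \<in> pverts T \<Longrightarrow> f v = interval_rep par pre post v"
  shows "optimal_overlap_rep T f" "overlap_number T = optimum"
proof -
  have "finite_overlap_rep T f"
    unfolding finite_overlap_rep_def overlap_rep_def
    using interval_rep_correct[OF assms(1)] eq by (auto simp: interval_rep_def)
  moreover have "rep_size T f \<le> optimum"
    using interval_rep_size[OF assms(1)] eq by (simp add: rep_size_def optimum_def)
  ultimately show "optimal_overlap_rep T f" "overlap_number T = optimum" using optimal_repI by blast+
qed

lemma overlap_number_eq_optimum: "overlap_number T = optimum"
proof -
  obtain par pre post k where "preorder_numbering par pre post k"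
    using preorder_numbering_exists by blast
  then show ?thesis by (rule optimal_interval_rep(2)[OF _ refl])
qed

lemma overlap_number_eq_skeleton:
  assumes "skeleton_of S T"
  shows "overlap_number T = card (pverts S)"
proof -
  have "optimum \<le> card (pverts S)" using optimal_skeleton_exists assms unfolding skeleton_of_def by metis
  moreover obtain par pre post k where "preorder_numbering par pre post k"
    using preorder_numbering_exists by blast
  then have "optimal_overlap_rep T (interval_rep par pre post)" using optimal_interval_rep(1)[OF _ refl] by blast
  then have "card (pverts S) \<le> overlap_number T"
    using skeleton_lower_bound[OF tree] assms optimum_ge_3 calculation
    unfolding optimal_overlap_rep_def skeleton_of_def by (metis order.trans)
  ultimately show ?thesis using overlap_number_eq_optimum by simp
qed

end

lemma end_rooted_graph_exists:
  assumes "undirected_tree T" "3 \<le> card (pverts T)"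
  shows "\<exists>r. end_rooted_graph T r"
proof -
  interpret arc_tree "pverts T" "parcs T" using undirected_tree_arc_tree assms by blast
  interpret big_tree "pverts T" "parcs T" by unfold_locales fact
  obtain r where "r \<in> inner" "card (parcs T `` {r} \<inter> inner) \<le> 1" using inner_end_exists by blast
  then have "end_rooted_graph T r" by unfold_locales (use assms in auto)
  then show ?thesis ..
qed

lemma skeleton_of_exists:
  assumes "undirected_tree T" "3 \<le> card (pverts T)"
  shows "\<exists>S. skeleton_of S T"
proof -
  obtain r where "end_rooted_graph T r" using end_rooted_graph_exists assms by blast
  then interpret end_rooted_graph T r .
  let ?P = "\<lambda>S. skeleton S \<and> subgraph (with_proj S) (with_proj T)"
  obtain S where "?P S" using optimal_skeleton_exists by blast
  moreover have "card (pverts S) < Suc (card (pverts T))" if "?P S" for S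
    using that finite_verts by (auto simp: subgraph_def less_Suc_eq_le intro: card_mono)
  ultimately have "\<exists>S. ?P S \<and> (\<forall>S'. ?P S' \<longrightarrow> card (pverts S') \<le> card (pverts S))"
    using ex_has_greatest_nat[of ?P S "\<lambda>S. card (pverts S)" "Suc (card (pverts T))"] by blast
  then show ?thesis unfolding skeleton_of_def by blast
qed

section \<open>Running time of programs\<close>

text \<open>
  Total correctness with a time bound: \<open>c\<close> halts within \<open>b\<close> steps in a memory that satisfies \<open>R\<close>.
\<close>

definition runs :: "com \<Rightarrow> memory \<Rightarrow> nat \<Rightarrow> (memory \<Rightarrow> bool) \<Rightarrow> bool" where
  "runs c s b R \<longleftrightarrow> (\<exists>t s'. exec c s t s' \<and> t \<le> b \<and> R s')"

primrec loop_free :: "com \<Rightarrow> bool" where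
  "loop_free Skip \<longleftrightarrow> True"
| "loop_free (Write a i e) \<longleftrightarrow> True"
| "loop_free (Seq c d) \<longleftrightarrow> loop_free c \<and> loop_free d"
| "loop_free (Cond b c d) \<longleftrightarrow> loop_free c \<and> loop_free d"
| "loop_free (While b c) \<longleftrightarrow> False"

primrec cost :: "com \<Rightarrow> nat" where
  "cost Skip = 1"
| "cost (Write a i e) = 1"
| "cost (Seq c d) = cost c + cost d"
| "cost (Cond b c d) = Suc (max (cost c) (cost d))"
| "cost (While b c) = 0"

text \<open>
  The loops of the program below are not nested, so their bodies can be evaluated by a recursive function
  and only the loops themselves need invariants.  On loops \<open>cost\<close> and \<open>effect\<close> take
  default values.
\<close>

primrec effect :: "com \<Rightarrow> memory \<Rightarrow> memory" where
  "effect Skip s = s"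
| "effect (Write a i e) s = s(a := (s a)(aval i s := aval e s))"
| "effect (Seq c d) s = effect d (effect c s)"
| "effect (Cond b c d) s = (if bval b s then effect c s else effect d s)"
| "effect (While b c) s = s"

lemma exec_loop_free: "loop_free c \<Longrightarrow> \<exists>t. exec c s t (effect c s) \<and> t \<le> cost c"
proof (induction c arbitrary: s)
  case Skip
  show ?case by (rule exI[of _ 1], rule conjI, unfold effect.simps, rule exec.skip, simp)
next
  case (Write a i e)
  show ?case by (rule exI[of _ 1], rule conjI, unfold effect.simps, rule exec.wr, simp)
next
  case (Seq c d)
  obtain t where "exec c s t (effect c s)" "t \<le> cost c" using Seq.IH(1)[of s] Seq.prems by auto
  moreover obtain u where "exec d (effect c s) u (effect d (effect c s))" "u \<le> cost d"
    using Seq.IH(2)[of "effect c s"] Seq.prems by auto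
  ultimately show ?case by (intro exI[of _ "t + u"]) (auto intro: exec.seq)
next
  case (Cond b c d)
  show ?case
  proof (cases "bval b s")
    case True
    obtain t where "exec c s t (effect c s)" "t \<le> cost c" using Cond.IH(1)[of s] Cond.prems by auto
    then show ?thesis using True by (intro exI[of _ "Suc t"]) (auto intro: exec.cond_true)
  next
    case False
    obtain t where "exec d s t (effect d s)" "t \<le> cost d" using Cond.IH(2)[of s] Cond.prems by auto
    then show ?thesis using False by (intro exI[of _ "Suc t"]) (auto intro: exec.cond_false)
  qed
qed simp

lemma runs_loop_free: "loop_free c \<Longrightarrow> R (effect c s) \<Longrightarrow> runs c s (cost c) R"
  using exec_loop_free[of c s] unfolding runs_def by blast

lemma runs_seq:
  assumes "runs c s b R" "\<And>s'. R s' \<Longrightarrow> runs d s' b' R'"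
  shows "runs (Seq c d) s (b + b') R'"
proof -
  obtain t s' where 1: "exec c s t s'" "t \<le> b" "R s'" using assms(1) unfolding runs_def by blast
  then obtain t' s'' where "exec d s' t' s''" "t' \<le> b'" "R' s''" using assms(2) unfolding runs_def by blast
  then show ?thesis unfolding runs_def using 1
    by (intro exI[of _ "t + t'"] exI[of _ s'']) (auto intro: exec.seq)
qed

lemma runs_mono: "runs c s b R \<Longrightarrow> b \<le> b' \<Longrightarrow> (\<And>s. R s \<Longrightarrow> R' s) \<Longrightarrow> runs c s b' R'"
  unfolding runs_def by (meson order.trans)

text \<open>
  The number \<open>m\<close> in the invariant bounds the number of iterations that are left.
\<close>

lemma runs_while:
  assumes lf: "loop_free c"
    and step: "\<And>m s. I m s \<Longrightarrow> bval b s \<Longrightarrow> \<exists>m'<m. I m' (effect c s)"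
    and exit: "\<And>m s. I m s \<Longrightarrow> \<not> bval b s \<Longrightarrow> R s"
    and init: "I m s"
  shows "runs (While b c) s (m * (cost c + 1) + 1) R"
  using init
proof (induction m arbitrary: s rule: less_induct)
  case (less m)
  show ?case
  proof (cases "bval b s")
    case True
    obtain m' where m': "m' < m" "I m' (effect c s)" using step[OF less.prems True] by blast
    obtain t s' where t: "exec (While b c) (effect c s) t s'" "t \<le> m' * (cost c + 1) + 1" "R s'"
      using less.IH[OF m'] unfolding runs_def by blast
    obtain u where u: "exec c s u (effect c s)" "u \<le> cost c" using exec_loop_free lf by blast
    have "exec (While b c) s (Suc (u + t)) s'" using True u t by (auto intro: exec.while_true)
    moreover have "Suc m' * (cost c + 1) \<le> m * (cost c + 1)" using m' by (intro mult_le_mono1) auto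
    then have "Suc (u + t) \<le> m * (cost c + 1) + 1" using u t by simp
    ultimately show ?thesis using t unfolding runs_def by blast
  next
    case False
    then show ?thesis using exit less.prems exec.while_false[OF False] unfolding runs_def by force
  qed
qed

section \<open>Linked adjacency lists\<close>

text \<open>
  The list of cells that starts at \<open>e\<close>; the address \<open>0\<close> ends a list.
\<close>

primrec linked :: "(nat \<Rightarrow> nat) \<Rightarrow> nat \<Rightarrow> nat list \<Rightarrow> bool" where
  "linked nxt e [] \<longleftrightarrow> e = 0"
| "linked nxt e (h # hs) \<longleftrightarrow> e = h \<and> h \<noteq> 0 \<and> linked nxt (nxt h) hs"

lemma linked_update: "h \<notin> set hs \<Longrightarrow> linked (nxt(h := x)) e hs \<longleftrightarrow> linked nxt e hs"
  by (induction hs arbitrary: e) auto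

text \<open>
  The cells of \<open>v\<close> hold, in some order and without repetition, the heads of the arcs in \<open>A\<close> that
  start at \<open>v\<close>.  Cells from \<open>h\<close> on are free.
\<close>

definition adj_lists :: "(nat \<Rightarrow> nat) \<Rightarrow> (nat \<Rightarrow> nat) \<Rightarrow> (nat \<Rightarrow> nat) \<Rightarrow> nat \<Rightarrow> (nat \<times> nat) set \<Rightarrow> bool" where
  "adj_lists first tgt nxt h A \<longleftrightarrow> 0 < h \<and>
     (\<forall>v. \<exists>hs. linked nxt (first v) hs \<and> set hs \<subseteq> {..<h} \<and> distinct (map tgt hs) \<and> tgt ` set hs = A `` {v})"

lemma adj_lists_insert:
  assumes "adj_lists first tgt nxt h A" "(a, b) \<notin> A"
  shows "adj_lists (first(a := h)) (tgt(h := b)) (nxt(h := first a)) (Suc h) (insert (a, b) A)"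
  unfolding adj_lists_def
proof (intro conjI allI)
  fix v
  obtain hs where hs: "linked nxt (first v) hs" "set hs \<subseteq> {..<h}" "distinct (map tgt hs)" "tgt ` set hs = A `` {v}"
    using assms(1) unfolding adj_lists_def by blast
  have h: "h \<notin> set hs" "0 < h" using hs(2) assms(1) unfolding adj_lists_def by auto
  have map: "map (tgt(h := b)) hs = map tgt hs" using h by auto
  then have img: "(tgt(h := b)) ` set hs = tgt ` set hs" by (metis set_map)
  let ?hs = "if v = a then h # hs else hs"
  have "linked (nxt(h := first a)) ((first(a := h)) v) ?hs" using hs h linked_update by auto
  moreover have "set ?hs \<subseteq> {..<Suc h}" using hs(2) by auto
  moreover have "distinct (map (tgt(h := b)) ?hs)"
    using hs(3,4) map assms(2) by (auto simp del: map_eq_conv)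
  moreover have "(tgt(h := b)) ` set ?hs = insert (a, b) A `` {v}" using hs(4) img by auto
  ultimately show "\<exists>hs. linked (nxt(h := first a)) ((first(a := h)) v) hs \<and> set hs \<subseteq> {..<Suc h} \<and>
      distinct (map (tgt(h := b)) hs) \<and> (tgt(h := b)) ` set hs = insert (a, b) A `` {v}" by blast
qed simp

lemma adj_lists_empty:
  assumes "adj_lists first tgt nxt h A" "first v = 0"
  shows "(v, y) \<notin> A"
proof -
  obtain hs where hs: "linked nxt (first v) hs" "tgt ` set hs = A `` {v}"
    using assms(1) unfolding adj_lists_def by blast
  then have "hs = []" using assms(2) by (cases hs) auto
  then show ?thesis using hs by auto
qed

lemma adj_lists_pop:
  assumes "adj_lists first tgt nxt h A" "first v \<noteq> 0"
  shows "(v, tgt (first v)) \<in> A"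
    "adj_lists (first(v := nxt (first v))) tgt nxt h (A - {(v, tgt (first v))})"
proof -
  have ex: "\<exists>hs. linked nxt (first u) hs \<and> set hs \<subseteq> {..<h} \<and> distinct (map tgt hs) \<and> tgt ` set hs = A `` {u}" for u
    using assms(1) unfolding adj_lists_def by blast
  obtain hs where hs: "linked nxt (first v) hs" "set hs \<subseteq> {..<h}" "distinct (map tgt hs)" "tgt ` set hs = A `` {v}"
    using ex by blast
  then obtain hs' where hs': "hs = first v # hs'" using assms(2) by (cases hs) auto
  then show "(v, tgt (first v)) \<in> A" using hs by auto
  show "adj_lists (first(v := nxt (first v))) tgt nxt h (A - {(v, tgt (first v))})"
    unfolding adj_lists_def
  proof (intro conjI allI)
    show "0 < h" using assms(1) unfolding adj_lists_def by blast
    fix u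
    show "\<exists>hs. linked nxt ((first(v := nxt (first v))) u) hs \<and> set hs \<subseteq> {..<h} \<and> distinct (map tgt hs)
        \<and> tgt ` set hs = (A - {(v, tgt (first v))}) `` {u}"
    proof (cases "u = v")
      case True
      have "tgt (first v) \<notin> tgt ` set hs'" using hs(3) hs' by simp
      moreover have "A `` {v} = insert (tgt (first v)) (tgt ` set hs')" using hs(4) hs' by simp
      ultimately have "tgt ` set hs' = A `` {v} - {tgt (first v)}" by simp
      then show ?thesis using True hs hs' by (intro exI[of _ hs']) auto
    next
      case False
      then have "(A - {(v, tgt (first v))}) `` {u} = A `` {u}" by auto
      then show ?thesis using ex[of u] False by simp
    qed
  qed
qed

definition degrees :: "(nat \<Rightarrow> nat) \<Rightarrow> (nat \<times> nat) set \<Rightarrow> bool" where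
  "degrees d A \<longleftrightarrow> (\<forall>v. d v = card (A `` {v}))"

lemma degrees_insert:
  assumes "degrees d A" "finite A" "(a, b) \<notin> A"
  shows "degrees (d(a := Suc (d a))) (insert (a, b) A)"
proof -
  have "insert (a, b) A `` {v} = (if v = a then insert b (A `` {v}) else A `` {v})" for v by auto
  then show ?thesis using assms unfolding degrees_def by (auto simp: finite_Image)
qed

section \<open>The program\<close>

text \<open>
  A variable is the entry 0 of an array.  Arrays 0 to 6 hold input and output.  The others are used
  as follows.
  \<^item> 7: loop variable; 8: first free list cell.
  \<^item> 9: degree of each vertex; 10: first list cell of each vertex; 11 and 12: content of a
    cell and the cell after it.
  \<^item> 13: number of inner neighbours of each vertex; 14: the root.
  \<^item> 15, 16, 17: parent, first and last number of each vertex; 18: last number given out.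
  \<^item> 19: current vertex of the search; 20: neighbour that is looked at.
\<close>

abbreviation var :: "nat \<Rightarrow> aexp" where "var a \<equiv> Read a (Const 0)"
abbreviation put :: "nat \<Rightarrow> aexp \<Rightarrow> com" where "put a e \<equiv> Write a (Const 0) e"

text \<open>
  Puts the end of the current edge that is listed in array \<open>y\<close> in front of the list of the end that is
  listed in array \<open>x\<close>.
\<close>

definition half_edge :: "nat \<Rightarrow> nat \<Rightarrow> com" where
  "half_edge x y = Seq (Write 9 (Read x (var 7)) (Inc (Read 9 (Read x (var 7)))))
    (Seq (Write 11 (var 8) (Read y (var 7)))
    (Seq (Write 12 (var 8) (Read 10 (Read x (var 7))))
    (Seq (Write 10 (Read x (var 7)) (var 8))
         (put 8 (Inc (var 8))))))"

text \<open>
  The number of edges is not part of the input, but the entries behind the last edge are 0, and no edge has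
  equal ends.
\<close>

definition more_edges :: bexp where
  "more_edges = Neg (Equal (Read 1 (var 7)) (Read 2 (var 7)))"

definition build_body :: com where
  "build_body = Seq (half_edge 1 2) (Seq (half_edge 2 1) (put 7 (Inc (var 7))))"

definition count_end :: "nat \<Rightarrow> nat \<Rightarrow> com" where
  "count_end x y = Cond (Less (Const 1) (Read 9 (Read y (var 7))))
     (Write 13 (Read x (var 7)) (Inc (Read 13 (Read x (var 7))))) Skip"

definition count_body :: com where
  "count_body = Seq (count_end 1 2) (Seq (count_end 2 1) (put 7 (Inc (var 7))))"

definition more_verts :: bexp where
  "more_verts = Less (var 7) (var 0)"

text \<open>
  Any inner vertex with at most one inner neighbour serves as the root.
\<close>

definition root_body :: com where
  "root_body = Seq (Cond (Conj (Less (Const 1) (Read 9 (var 7))) (Less (Read 13 (var 7)) (Const 2)))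
     (put 14 (var 7)) Skip) (put 7 (Inc (var 7)))"

text \<open>
  The parent of the root is set to \<open>n\<close>.  This is not a vertex, so it ends the search when it becomes
  the current one, and its number \<open>0\<close> is the left end of the interval of the root.
\<close>

definition dfs_start :: com where
  "dfs_start = Seq (Write 15 (var 14) (var 0)) (Seq (put 18 (Const 1))
     (Seq (Write 16 (var 14) (Const 1)) (put 19 (var 14))))"

definition dfs_close :: com where
  "dfs_close = Seq (Cond (Equal (Read 16 (var 19)) (var 18)) (put 18 (Inc (var 18))) Skip)
     (Seq (Write 17 (var 19) (var 18)) (put 19 (Read 15 (var 19))))"

definition dfs_pop :: com where
  "dfs_pop = Seq (put 20 (Read 11 (Read 10 (var 19)))) (Write 10 (var 19) (Read 12 (Read 10 (var 19))))"

definition dfs_visit :: com where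
  "dfs_visit = Seq (Write 15 (var 20) (var 19))
     (Cond (Less (Const 1) (Read 9 (var 20)))
        (Seq (put 18 (Inc (var 18))) (Seq (Write 16 (var 20) (var 18)) (put 19 (var 20)))) Skip)"

definition dfs_body :: com where
  "dfs_body = Cond (Equal (Read 10 (var 19)) (Const 0)) dfs_close
     (Seq dfs_pop (Cond (Equal (var 20) (Read 15 (var 19))) Skip dfs_visit))"

definition output_body :: com where
  "output_body = Seq (Write 4 (var 7) (var 7))
    (Seq (Write 5 (var 7) (Read 16 (Read 15 (var 7))))
    (Seq (Cond (Less (Const 1) (Read 9 (var 7)))
       (Write 6 (var 7) (Read 16 (var 7))) (Write 6 (var 7) (Read 17 (Read 15 (var 7)))))
    (put 7 (Inc (var 7)))))"

definition dfs :: com where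
  "dfs = Seq dfs_start (While (Less (var 19) (var 0)) dfs_body)"

definition program :: com where
  "program = Seq (put 8 (Const 1)) (Seq (While more_edges build_body)
    (Seq (put 7 (Const 0)) (Seq (While more_edges count_body)
    (Seq (put 7 (Const 0)) (Seq (While more_verts root_body)
    (Seq dfs
    (Seq (Seq (put 3 (var 0)) (put 7 (Const 0))) (While more_verts output_body))))))))"

text \<open>
  Coefficients of \<open>n\<close> for the five loops, and 5 twice to absorb, for \<open>n \<ge> 1\<close>, the steps outside
  of the loops and their final tests.
\<close>

definition time_bound :: nat where
  "time_bound = 5 + (cost build_body + 1) + (cost count_body + 1) + (cost root_body + 1)
     + (cost dfs_start + 3 * (cost dfs_body + 1)) + (cost output_body + 1) + 5"

lemma loop_free_parts [simp]: "loop_free build_body" "loop_free count_body" "loop_free root_body"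
    "loop_free dfs_start" "loop_free dfs_body" "loop_free output_body"
  by (simp_all add: build_body_def half_edge_def count_body_def count_end_def root_body_def dfs_start_def
      dfs_body_def dfs_close_def dfs_pop_def dfs_visit_def output_body_def)

lemma effect_half_edge:
  fixes x y :: nat and s :: memory
  assumes "x < 3" "y < 3"
  defines "a \<equiv> s x (s 7 0)" and "b \<equiv> s y (s 7 0)" and "s' \<equiv> effect (half_edge x y) s"
  shows "s' 9 = (s 9)(a := Suc (s 9 a))" "s' 10 = (s 10)(a := s 8 0)" "s' 11 = (s 11)(s 8 0 := b)"
    "s' 12 = (s 12)(s 8 0 := s 10 a)" "s' 8 0 = Suc (s 8 0)" "c \<notin> {8, 9, 10, 11, 12} \<Longrightarrow> s' c = s c"
proof -
  have "x \<noteq> 8" "x \<noteq> 9" "x \<noteq> 10" "x \<noteq> 11" "x \<noteq> 12" "y \<noteq> 8" "y \<noteq> 9" "y \<noteq> 10" "y \<noteq> 11" "y \<noteq> 12"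
    using assms(1,2) by simp_all
  then show "s' 9 = (s 9)(a := Suc (s 9 a))" "s' 10 = (s 10)(a := s 8 0)" "s' 11 = (s 11)(s 8 0 := b)"
    "s' 12 = (s 12)(s 8 0 := s 10 a)" "s' 8 0 = Suc (s 8 0)" "c \<notin> {8, 9, 10, 11, 12} \<Longrightarrow> s' c = s c"
    unfolding half_edge_def a_def b_def s'_def by simp_all
qed

locale tree_input =
  fixes T :: "nat pair_pre_digraph" and n :: nat and es :: "(nat \<times> nat) list"
  assumes tree: "undirected_tree T" and n3: "3 \<le> n" and verts: "pverts T = {..<n}" and edges: "edge_list T es"
begin

abbreviation "E \<equiv> parcs T"
abbreviation "s0 \<equiv> input_memory n es"

sublocale big_tree "pverts T" "parcs T"
proof -
  interpret arc_tree "pverts T" "parcs T" using undirected_tree_arc_tree tree by blast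
  show "big_tree (pverts T) (parcs T)" by unfold_locales (use n3 verts in simp)
qed

definition read_arcs :: "nat \<Rightarrow> (nat \<times> nat) set" where
  "read_arcs i = set (take i es) \<union> (set (take i es))\<inverse>"

lemma read_arcs_0: "read_arcs 0 = {}"
  and read_arcs_all: "read_arcs (length es) = E"
  and finite_read_arcs: "finite (read_arcs i)"
  using edges by (simp_all add: read_arcs_def edge_list_def)

lemma read_arcs_Suc:
  assumes "i < length es"
  shows "read_arcs (Suc i) = insert (snd (es ! i), fst (es ! i)) (insert (fst (es ! i), snd (es ! i)) (read_arcs i))"
    and "(fst (es ! i), snd (es ! i)) \<notin> read_arcs i" "(snd (es ! i), fst (es ! i)) \<notin> read_arcs i"
    and "fst (es ! i) \<noteq> snd (es ! i)"
proof -
  let ?e = "es ! i"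
  have e: "?e \<in> set es" using assms by simp
  then have "?e \<in> E" using edges by (auto simp: edge_list_def)
  then show ne: "fst ?e \<noteq> snd ?e" using arcs_irrefl by (metis prod.collapse)
  show "read_arcs (Suc i) = insert (snd ?e, fst ?e) (insert (fst ?e, snd ?e) (read_arcs i))"
    using assms by (cases ?e) (auto simp: read_arcs_def take_Suc_conv_app_nth)
  have new: "?e \<notin> set (take i es)"
  proof
    assume "?e \<in> set (take i es)"
    then obtain j where "j < i" "es ! j = ?e" using assms by (auto simp: in_set_conv_nth)
    then show False using edges assms nth_eq_iff_index_eq[of es j i] by (auto simp: edge_list_def)
  qed
  have sub: "set (take i es) \<subseteq> set es" by (rule set_take_subset)
  have "(snd ?e, fst ?e) \<notin> set es"
  proof
    assume "(snd ?e, fst ?e) \<in> set es"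
    then have "?e \<in> set es \<inter> (set es)\<inverse>" using e by (cases ?e) auto
    moreover have "set es \<inter> (set es)\<inverse> = {}" using edges by (simp add: edge_list_def)
    ultimately show False by (simp only: empty_iff)
  qed
  then have "(snd ?e, fst ?e) \<notin> set (take i es)" using sub by blast
  then show "(fst ?e, snd ?e) \<notin> read_arcs i" "(snd ?e, fst ?e) \<notin> read_arcs i"
    using new unfolding read_arcs_def by (cases ?e; simp)+
qed

lemma card_arcs: "card E \<le> 2 * n"
proof -
  have "0 \<in> pverts T" using verts n3 by simp
  then have "pverts T \<noteq> {}" by blast
  then have "card (E \<inter> pverts T \<times> pverts T) \<le> 2 * n" using sparse[of "pverts T"] verts by auto
  then show ?thesis using arcs_in by (simp add: Int_absorb2)
qed

lemma length_edges: "length es \<le> n"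
proof -
  have d: "distinct es" "set es \<inter> (set es)\<inverse> = {}" "E = set es \<union> (set es)\<inverse>"
    using edges by (auto simp: edge_list_def)
  have "card E = card (set es) + card ((set es)\<inverse>)"
    unfolding d(3) using d(2) by (intro card_Un_disjoint) auto
  then have "card E = 2 * length es" using d(1) by (simp add: distinct_card)
  then show ?thesis using card_arcs by simp
qed

lemma input_edge: "i < length es \<Longrightarrow> s0 1 i = fst (es ! i)" "i < length es \<Longrightarrow> s0 2 i = snd (es ! i)"
    "s0 1 (length es) = 0" "s0 2 (length es) = 0"
  by (auto simp: input_memory_def)

lemma more_edges_iff:
  assumes "s 7 0 = i" "s 1 = s0 1" "s 2 = s0 2" "i \<le> length es"
  shows "bval more_edges s \<longleftrightarrow> i < length es"
proof (cases "i < length es")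
  case True
  then show ?thesis using assms input_edge read_arcs_Suc(4)[OF True] by (simp add: more_edges_def)
next
  case False
  then have "i = length es" using assms by simp
  then show ?thesis using assms input_edge by (simp add: more_edges_def)
qed

text \<open>
  The first \<open>i\<close> edges have been entered into the adjacency lists.
\<close>

definition built :: "memory \<Rightarrow> nat \<Rightarrow> bool" where
  "built s i \<longleftrightarrow> s 0 0 = n \<and> s 1 = s0 1 \<and> s 2 = s0 2 \<and> degrees (s 9) (read_arcs i) \<and>
     adj_lists (s 10) (s 11) (s 12) (s 8 0) (read_arcs i)"

lemma runs_build:
  assumes "s 0 0 = n" "s 1 = s0 1" "s 2 = s0 2" "\<And>a. 7 \<le> a \<Longrightarrow> a \<noteq> 8 \<Longrightarrow> s a = (\<lambda>_. 0)" "s 8 0 = 1"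
  shows "runs (While more_edges build_body) s (n * (cost build_body + 1) + 1)
    (\<lambda>s. built s (length es) \<and> (\<forall>a\<ge>13. s a = (\<lambda>_. 0)))"
proof -
  let ?I = "\<lambda>m s. \<exists>i\<le>length es. m = length es - i \<and> s 7 0 = i \<and> built s i \<and> (\<forall>a\<ge>13. s a = (\<lambda>_. 0))"
  have "runs (While more_edges build_body) s (length es * (cost build_body + 1) + 1)
    (\<lambda>s. built s (length es) \<and> (\<forall>a\<ge>13. s a = (\<lambda>_. 0)))"
  proof (rule runs_while[where I = ?I])
    fix m s assume I: "?I m s" and b: "bval more_edges s"
    then obtain i where i: "i \<le> length es" "m = length es - i" "s 7 0 = i" and bi: "built s i"
      and z: "\<forall>a\<ge>13. s a = (\<lambda>_. 0)" by blast
    then have il: "i < length es" using more_edges_iff[of s i] b by (simp add: built_def)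
    define a b where "a = fst (es ! i)" and "b = snd (es ! i)"
    note new = read_arcs_Suc[OF il, folded a_def b_def]
    define s1 where "s1 = effect (half_edge 1 2) s"
    define s2 where "s2 = effect (half_edge 2 1) s1"
    have e1: "s1 9 = (s 9)(a := Suc (s 9 a))" "s1 10 = (s 10)(a := s 8 0)" "s1 11 = (s 11)(s 8 0 := b)"
      "s1 12 = (s 12)(s 8 0 := s 10 a)" "s1 8 0 = Suc (s 8 0)" "\<And>c. c \<notin> {8, 9, 10, 11, 12} \<Longrightarrow> s1 c = s c"
      using effect_half_edge[where x = 1 and y = 2 and s = s] i bi input_edge(1,2)[of i] il by (simp_all add: s1_def built_def a_def b_def)
    have e2: "s2 9 = (s1 9)(b := Suc (s1 9 b))" "s2 10 = (s1 10)(b := s1 8 0)" "s2 11 = (s1 11)(s1 8 0 := a)"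
      "s2 12 = (s1 12)(s1 8 0 := s1 10 b)" "s2 8 0 = Suc (s1 8 0)" "\<And>c. c \<notin> {8, 9, 10, 11, 12} \<Longrightarrow> s2 c = s1 c"
      using effect_half_edge[where x = 2 and y = 1 and s = s1] e1(6) i bi input_edge(1,2)[of i] il
      by (simp_all add: s2_def built_def a_def b_def)
    have eff: "effect build_body s = s2(7 := (s2 7)(0 := Suc i))"
      using e1(6) e2(6) i by (simp add: build_body_def s1_def s2_def)
    have ba: "(b, a) \<notin> insert (a, b) (read_arcs i)" using new by auto
    have "degrees (s1 9) (insert (a, b) (read_arcs i))"
      unfolding e1 using bi finite_read_arcs new by (intro degrees_insert) (auto simp: built_def)
    then have "degrees (s2 9) (read_arcs (Suc i))"
      unfolding e2 new(1) using finite_read_arcs ba by (intro degrees_insert) auto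
    moreover have "adj_lists (s1 10) (s1 11) (s1 12) (s1 8 0) (insert (a, b) (read_arcs i))"
      unfolding e1 using bi new by (intro adj_lists_insert) (auto simp: built_def)
    then have "adj_lists (s2 10) (s2 11) (s2 12) (s2 8 0) (read_arcs (Suc i))"
      unfolding e2 new(1) using ba by (intro adj_lists_insert) auto
    ultimately have "built (effect build_body s) (Suc i)"
      using bi e1(6) e2(6) unfolding eff built_def by simp
    moreover have "\<forall>a\<ge>13. effect build_body s a = (\<lambda>_. 0)" using z e1(6) e2(6) eff by simp
    ultimately show "\<exists>m'<m. ?I m' (effect build_body s)"
      using il i eff by (intro exI[of _ "length es - Suc i"]) auto
  next
    fix m s assume I: "?I m s" and b: "\<not> bval more_edges s"
    then obtain i where i: "i \<le> length es" "s 7 0 = i" "built s i" "\<forall>a\<ge>13. s a = (\<lambda>_. 0)" by blast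
    then have "i = length es" using more_edges_iff[of s i] b by (simp add: built_def)
    then show "built s (length es) \<and> (\<forall>a\<ge>13. s a = (\<lambda>_. 0))" using i by blast
  next
    have "built s 0" using assms by (auto simp: built_def read_arcs_0 degrees_def adj_lists_def)
    then show "?I (length es) s" using assms by (intro exI[of _ 0]) auto
  qed simp
  moreover have "length es * (k + 1) + 1 \<le> n * (k + 1) + 1" for k
    using length_edges by (intro add_right_mono mult_le_mono1)
  ultimately show ?thesis by (rule runs_mono) simp
qed

text \<open>
  Restricted to these arcs, the degree of a vertex is the number of its inner neighbours.
\<close>

definition nonleaf_arcs :: "(nat \<times> nat) set" where
  "nonleaf_arcs = {(v, y). y \<in> inner}"

lemma degree_inner:
  assumes "degrees d E"
  shows "Suc 0 < d v \<longleftrightarrow> v \<in> inner"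
proof -
  have "v \<in> pverts T" if "card (E `` {v}) \<noteq> 0" using that arcD by (metis Image_singleton_iff card.empty equals0I)
  then show ?thesis using assms unfolding degrees_def inner_def by auto
qed

lemma effect_count_end:
  assumes "x < 3" "y < 3" "degrees (s 9) E" "degrees (s 13) (A \<inter> nonleaf_arcs)" "finite A"
    "(s x (s 7 0), s y (s 7 0)) \<notin> A"
  shows "degrees (effect (count_end x y) s 13) (insert (s x (s 7 0), s y (s 7 0)) A \<inter> nonleaf_arcs)"
    and "c \<noteq> 13 \<Longrightarrow> effect (count_end x y) s c = s c"
proof -
  have 1: "Suc 0 < s 9 (s y (s 7 0)) \<longleftrightarrow> s y (s 7 0) \<in> inner" using degree_inner assms(3) by blast
  show "c \<noteq> 13 \<Longrightarrow> effect (count_end x y) s c = s c" by (simp add: count_end_def)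
  show "degrees (effect (count_end x y) s 13) (insert (s x (s 7 0), s y (s 7 0)) A \<inter> nonleaf_arcs)"
  proof (cases "s y (s 7 0) \<in> inner")
    case True
    then have "insert (s x (s 7 0), s y (s 7 0)) A \<inter> nonleaf_arcs
        = insert (s x (s 7 0), s y (s 7 0)) (A \<inter> nonleaf_arcs)" by (auto simp: nonleaf_arcs_def)
    then show ?thesis using degrees_insert[OF assms(4), of "s x (s 7 0)" "s y (s 7 0)"] assms True 1
      by (simp add: count_end_def)
  next
    case False
    then have "insert (s x (s 7 0), s y (s 7 0)) A \<inter> nonleaf_arcs = A \<inter> nonleaf_arcs"
      by (auto simp: nonleaf_arcs_def)
    then show ?thesis using False 1 assms by (simp add: count_end_def)
  qed
qed

definition counted :: "memory \<Rightarrow> bool" where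
  "counted s \<longleftrightarrow> s 0 0 = n \<and> degrees (s 9) E \<and> adj_lists (s 10) (s 11) (s 12) (s 8 0) E"

lemma runs_count:
  assumes "built s (length es)" "s 7 0 = 0" "\<forall>a\<ge>13. s a = (\<lambda>_. 0)"
  shows "runs (While more_edges count_body) s (n * (cost count_body + 1) + 1)
    (\<lambda>s. counted s \<and> degrees (s 13) (E \<inter> nonleaf_arcs) \<and> (\<forall>a\<ge>14. s a = (\<lambda>_. 0)))"
    (is "runs _ _ _ ?R")
proof -
  let ?I = "\<lambda>m s. \<exists>i\<le>length es. m = length es - i \<and> s 7 0 = i \<and> built s (length es)
    \<and> degrees (s 13) (read_arcs i \<inter> nonleaf_arcs) \<and> (\<forall>a\<ge>14. s a = (\<lambda>_. 0))"
  have "runs (While more_edges count_body) s (length es * (cost count_body + 1) + 1) ?R"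
  proof (rule runs_while[where I = ?I])
    fix m s assume I: "?I m s" and b: "bval more_edges s"
    then obtain i where i: "i \<le> length es" "m = length es - i" "s 7 0 = i" and bi: "built s (length es)"
      and d: "degrees (s 13) (read_arcs i \<inter> nonleaf_arcs)" and z: "\<forall>a\<ge>14. s a = (\<lambda>_. 0)" by blast
    then have il: "i < length es" using more_edges_iff[of s i] b by (simp add: built_def)
    define a b where "a = fst (es ! i)" and "b = snd (es ! i)"
    note new = read_arcs_Suc[OF il, folded a_def b_def]
    define s1 where "s1 = effect (count_end 1 2) s"
    define s2 where "s2 = effect (count_end 2 1) s1"
    have dE: "degrees (s 9) E" using bi read_arcs_all by (simp add: built_def)
    have ab: "s 1 (s 7 0) = a" "s 2 (s 7 0) = b"
      using i bi input_edge(1,2)[of i] il by (simp_all add: built_def a_def b_def)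
    have s1: "degrees (s1 13) (insert (a, b) (read_arcs i) \<inter> nonleaf_arcs)" "\<And>c. c \<noteq> 13 \<Longrightarrow> s1 c = s c"
      using effect_count_end[where x = 1 and y = 2 and s = s and A = "read_arcs i"] dE d finite_read_arcs new ab by (simp_all add: s1_def)
    have s2: "degrees (s2 13) (read_arcs (Suc i) \<inter> nonleaf_arcs)" "\<And>c. c \<noteq> 13 \<Longrightarrow> s2 c = s1 c"
      using effect_count_end[where x = 2 and y = 1 and s = s1 and A = "insert (a, b) (read_arcs i)"] dE s1 finite_read_arcs new ab
      by (simp_all add: s2_def)
    have eff: "effect count_body s = s2(7 := (s2 7)(0 := Suc i))"
      using s1 s2 i by (simp add: count_body_def s1_def s2_def)
    have "built (effect count_body s) (length es)" using bi s1(2) s2(2) unfolding eff built_def by simp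
    moreover have "\<forall>a\<ge>14. effect count_body s a = (\<lambda>_. 0)" using z s1(2) s2(2) eff by simp
    ultimately show "\<exists>m'<m. ?I m' (effect count_body s)"
      using il i eff s2(1) by (intro exI[of _ "length es - Suc i"]) auto
  next
    fix m s assume I: "?I m s" and b: "\<not> bval more_edges s"
    then obtain i where i: "i \<le> length es" "s 7 0 = i" "built s (length es)"
      "degrees (s 13) (read_arcs i \<inter> nonleaf_arcs)" "\<forall>a\<ge>14. s a = (\<lambda>_. 0)" by blast
    then have "i = length es" using more_edges_iff[of s i] b by (simp add: built_def)
    then show "?R s" using i read_arcs_all by (simp add: built_def counted_def)
  next
    show "?I (length es) s" using assms by (intro exI[of _ 0]) (auto simp: read_arcs_0 degrees_def)
  qed simp
  moreover have "length es * (k + 1) + 1 \<le> n * (k + 1) + 1" for k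
    using length_edges by (intro add_right_mono mult_le_mono1)
  ultimately show ?thesis by (rule runs_mono) simp
qed

definition good_root :: "nat \<Rightarrow> bool" where
  "good_root r \<longleftrightarrow> r \<in> inner \<and> card (E `` {r} \<inter> inner) \<le> 1"

lemma runs_root:
  assumes "counted s" "degrees (s 13) (E \<inter> nonleaf_arcs)" "s 7 0 = 0" "\<forall>a\<ge>14. s a = (\<lambda>_. 0)"
  shows "runs (While more_verts root_body) s (n * (cost root_body + 1) + 1)
    (\<lambda>s. counted s \<and> good_root (s 14 0) \<and> (\<forall>a\<ge>15. s a = (\<lambda>_. 0)))"
    (is "runs _ _ _ ?R")
proof -
  let ?I = "\<lambda>m s. \<exists>i\<le>n. m = n - i \<and> s 7 0 = i \<and> counted s \<and> degrees (s 13) (E \<inter> nonleaf_arcs)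
    \<and> ((\<exists>j<i. good_root j) \<longrightarrow> good_root (s 14 0)) \<and> (\<forall>a\<ge>15. s a = (\<lambda>_. 0))"
  show ?thesis
  proof (rule runs_while[where I = ?I])
    fix m s assume I: "?I m s" and b: "bval more_verts s"
    then obtain i where i: "i \<le> n" "m = n - i" "s 7 0 = i" and c: "counted s"
      and d: "degrees (s 13) (E \<inter> nonleaf_arcs)"
      and g: "(\<exists>j<i. good_root j) \<longrightarrow> good_root (s 14 0)" and z: "\<forall>a\<ge>15. s a = (\<lambda>_. 0)" by blast
    have il: "i < n" using b i c by (simp add: more_verts_def counted_def)
    have "(E \<inter> nonleaf_arcs) `` {i} = E `` {i} \<inter> inner" by (auto simp: nonleaf_arcs_def)
    then have "s 13 i = card (E `` {i} \<inter> inner)" using d by (simp add: degrees_def)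
    moreover have "Suc 0 < s 9 i \<longleftrightarrow> i \<in> inner" using c degree_inner by (simp add: counted_def)
    ultimately have test: "Suc 0 < s 9 i \<and> s 13 i < 2 \<longleftrightarrow> good_root i"
      by (auto simp: good_root_def)
    define s1 where "s1 = (if good_root i then s(14 := (s 14)(0 := i)) else s)"
    have eff: "effect root_body s = s1(7 := (s1 7)(0 := Suc i))"
      using test i by (auto simp: root_body_def s1_def)
    have "counted (effect root_body s)" using c by (simp add: eff s1_def counted_def)
    moreover have "(\<exists>j<Suc i. good_root j) \<longrightarrow> good_root (effect root_body s 14 0)"
      using g by (auto simp: eff s1_def less_Suc_eq)
    moreover have "degrees (effect root_body s 13) (E \<inter> nonleaf_arcs)" using d by (simp add: eff s1_def)
    moreover have "\<forall>a\<ge>15. effect root_body s a = (\<lambda>_. 0)" using z by (simp add: eff s1_def)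
    moreover have "effect root_body s 7 0 = Suc i" by (simp add: eff)
    ultimately show "\<exists>m'<m. ?I m' (effect root_body s)"
      using il i by (intro exI[of _ "n - Suc i"] conjI exI[of _ "Suc i"]) auto
  next
    fix m s assume I: "?I m s" and b: "\<not> bval more_verts s"
    then obtain i where i: "i \<le> n" "s 7 0 = i" "counted s"
      "(\<exists>j<i. good_root j) \<longrightarrow> good_root (s 14 0)" "\<forall>a\<ge>15. s a = (\<lambda>_. 0)" by blast
    then have "i = n" using b by (simp add: more_verts_def counted_def)
    moreover have "\<exists>j<n. good_root j" using inner_end_exists inner_sub verts unfolding good_root_def by blast
    ultimately show "?R s" using i by blast
  next
    show "?I n s" using assms by (intro exI[of _ 0]) auto
  qed simp
qed

definition searched :: "memory \<Rightarrow> nat \<Rightarrow> bool" where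
  "searched s r \<longleftrightarrow> s 0 0 = n \<and> degrees (s 9) E \<and> s 15 r = n \<and> s 16 n = 0"

text \<open>
  The abstract search state as it is laid out in memory.  The stack is not stored: it is the path of
  parents from the current vertex to the root.
\<close>

definition dfs_memory :: "nat \<Rightarrow> memory \<Rightarrow> nat list \<Rightarrow> nat set \<Rightarrow> (nat \<times> nat) set \<Rightarrow> bool" where
  "dfs_memory r s st D Q \<longleftrightarrow> searched s r \<and> adj_lists (s 10) (s 11) (s 12) (s 8 0) Q \<and>
     dfs_state (pverts T) E r (s 15) (s 16) (s 17) (s 18 0) st D Q \<and>
     s 19 0 = (case st of [] \<Rightarrow> n | v # _ \<Rightarrow> v)"

text \<open>
  An iteration either takes an arc off \<open>Q\<close> or closes a vertex, which gives the linear running time.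
\<close>

lemma dfs_body_step:
  assumes "dfs_memory r s st D Q" "s 19 0 < n"
  shows "\<exists>st' D' Q'. dfs_memory r (effect dfs_body s) st' D' Q' \<and>
    card Q' + card (inner - (D' - set st')) < card Q + card (inner - (D - set st))"
proof -
  interpret dfs_state "pverts T" E r "s 15" "s 16" "s 17" "s 18 0" st D Q
    using assms(1) by (simp add: dfs_memory_def)
  obtain v rest where st: "st = v # rest" and v19: "s 19 0 = v"
    using assms by (cases st) (auto simp: dfs_memory_def)
  have adj: "adj_lists (s 10) (s 11) (s 12) (s 8 0) Q" using assms(1) by (simp add: dfs_memory_def)
  have se: "s 0 0 = n" "degrees (s 9) E" "s 15 r = n" "s 16 n = 0"
    using assms(1) by (auto simp: dfs_memory_def searched_def)
  have vD: "v \<in> D" using st stack_opened by auto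
  have finQ: "finite Q" by (rule finite_subset[OF pending finite_arcs])
  show ?thesis
  proof (cases "s 10 v = 0")
    case True
    define k' where "k' = (if s 16 v = s 18 0 then s 18 0 + 1 else s 18 0)"
    have no: "(v, y) \<notin> Q" for y using adj_lists_empty[OF adj True] .
    have par: "s 15 v = (case rest of [] \<Rightarrow> n | u # _ \<Rightarrow> u)"
    proof (cases rest)
      case Nil
      then show ?thesis using stack_root st se by simp
    next
      case (Cons u us)
      then show ?thesis using stack_parents st by simp
    qed
    have eff: "effect dfs_body s = s(18 := (s 18)(0 := k'), 17 := (s 17)(v := k'), 19 := (s 19)(0 := s 15 v))"
      using v19 True by (auto simp: dfs_body_def dfs_close_def k'_def fun_eq_iff)
    have "dfs_state (pverts T) E r (s 15) (s 16) ((s 17)(v := k')) k' rest D Q"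
      by (rule step_close[OF st no k'_def])
    then have "dfs_memory r (effect dfs_body s) rest D Q"
      using adj par se by (simp add: eff dfs_memory_def searched_def)
    moreover have "v \<notin> set rest" using stack_sorted st by auto
    then have "card (inner - (D - set rest)) < card (inner - (D - set st))"
      using st vD opened_inner finite_inner by (intro psubset_card_mono) auto
    ultimately show ?thesis by (intro exI[of _ rest] exI[of _ D] exI[of _ Q]) simp
  next
    case False
    define y where "y = s 11 (s 10 v)"
    define s1 where "s1 = s(20 := (s 20)(0 := y), 10 := (s 10)(v := s 12 (s 10 v)))"
    let ?Q = "Q - {(v, y)}"
    have y: "(v, y) \<in> Q" and adj': "adj_lists (s1 10) (s1 11) (s1 12) (s1 8 0) ?Q"
      using adj_lists_pop[OF adj False] by (simp_all add: y_def s1_def)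
    have dec: "card ?Q < card Q" using y finQ by (rule card_Diff1_less[rotated])
    have vy: "(v, y) \<in> E" using y pending by blast
    then have yn: "y < n" using arcD(2) verts by blast
    have pop: "effect dfs_pop s = s1" using v19 by (simp add: dfs_pop_def s1_def y_def fun_eq_iff)
    show ?thesis
    proof (cases "y = s 15 v")
      case True
      then have vr: "v \<noteq> r" using se yn by auto
      have eff: "effect dfs_body s = s1"
        using v19 \<open>s 10 v \<noteq> 0\<close> pop True by (simp add: dfs_body_def) (simp add: s1_def)
      have "dfs_memory r s1 st D ?Q"
        using step_back[OF vr vD True] adj' se v19 st by (simp add: dfs_memory_def searched_def s1_def)
      then show ?thesis using eff dec by (intro exI[of _ st] exI[of _ D] exI[of _ ?Q]) simp
    next
      case np: False
      have yr: "y \<notin> inner \<Longrightarrow> y \<noteq> r" using root by auto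
      show ?thesis
      proof (cases "y \<in> inner")
        case True
        define s2 where "s2 = s1(15 := (s 15)(y := v), 18 := (s 18)(0 := s 18 0 + 1),
            16 := (s 16)(y := s 18 0 + 1), 19 := (s 19)(0 := y))"
        have "Suc 0 < s 9 y" using True degree_inner se by blast
        then have eff: "effect dfs_body s = s2"
          using v19 \<open>s 10 v \<noteq> 0\<close> pop np
          by (simp add: dfs_body_def dfs_visit_def) (simp add: s1_def s2_def fun_eq_iff)
        have yD: "y \<notin> D" using new_vertex vD y np by blast
        then have "y \<noteq> r" using root_opened by auto
        have "dfs_state (pverts T) E r ((s 15)(y := v)) ((s 16)(y := s 18 0 + 1)) (s 17) (s 18 0 + 1)
            (y # st) (insert y D) ?Q"
          using step_open[OF st y True] np by blast
        then have "dfs_memory r s2 (y # st) (insert y D) ?Q"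
          using adj' se \<open>y \<noteq> r\<close> yn by (simp add: dfs_memory_def searched_def s1_def s2_def)
        moreover have "insert y D - set (y # st) = D - set st" using yD by auto
        ultimately show ?thesis using eff dec
          by (intro exI[of _ "y # st"] exI[of _ "insert y D"] exI[of _ ?Q]) simp
      next
        case False
        define s2 where "s2 = s1(15 := (s 15)(y := v))"
        have "\<not> Suc 0 < s 9 y" using False degree_inner se by blast
        then have eff: "effect dfs_body s = s2"
          using v19 \<open>s 10 v \<noteq> 0\<close> pop np
          by (simp add: dfs_body_def dfs_visit_def) (simp add: s1_def s2_def fun_eq_iff)
        have "dfs_memory r s2 st D ?Q"
          using step_leaf[OF vD y False] adj' se yr[OF False] v19 st
          by (simp add: dfs_memory_def searched_def s1_def s2_def)
        then show ?thesis using eff dec by (intro exI[of _ st] exI[of _ D] exI[of _ ?Q]) simp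
      qed
    qed
  qed
qed

lemma runs_dfs:
  assumes s: "counted s" "good_root (s 14 0)" "\<forall>a\<ge>15. s a = (\<lambda>_. 0)"
  defines "r \<equiv> s 14 0"
  shows "runs (Seq dfs_start (While (Less (var 19) (var 0)) dfs_body)) s
    (cost dfs_start + (3 * n * (cost dfs_body + 1) + 1))
    (\<lambda>s. searched s r \<and> end_rooted_graph T r \<and>
       inner_rooted_tree.preorder_numbering (pverts T) E r (s 15) (s 16) (s 17) (s 18 0))"
    (is "runs _ _ _ ?R")
proof -
  have ert: "end_rooted_graph T r"
    by unfold_locales (use s(2) tree in \<open>auto simp: good_root_def r_def\<close>)
  interpret end_rooted_graph T r by (fact ert)
  let ?I = "\<lambda>m s. \<exists>st D Q. dfs_memory r s st D Q \<and> m = card Q + card (inner - (D - set st))"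
  let ?m = "card E + card (inner - ({r} - {r}))"
  let ?b = "Less (var 19) (var 0)"
  have rn: "r < n" using root inner_sub verts by auto
  have loop: "runs (While ?b dfs_body) s' (3 * n * (cost dfs_body + 1) + 1) ?R"
    if s': "dfs_memory r s' [r] {r} E" for s'
  proof -
    have "runs (While ?b dfs_body) s' (?m * (cost dfs_body + 1) + 1) ?R"
    proof (rule runs_while[where I = ?I])
      fix m s assume "?I m s" and b: "bval ?b s"
      then obtain st D Q where I: "dfs_memory r s st D Q" "m = card Q + card (inner - (D - set st))" by blast
      moreover have "s 19 0 < n" using b I by (simp add: dfs_memory_def searched_def)
      ultimately show "\<exists>m'<m. ?I m' (effect dfs_body s)" using dfs_body_step[of r s st D Q] by blast
    next
      fix m s assume "?I m s" and b: "\<not> bval ?b s"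
      then obtain st D Q where I: "dfs_memory r s st D Q" by blast
      then interpret d: dfs_state "pverts T" E r "s 15" "s 16" "s 17" "s 18 0" st D Q
        by (simp add: dfs_memory_def)
      have "st = []"
      proof (rule ccontr)
        assume "st \<noteq> []"
        then obtain v rest where st: "st = v # rest" by (cases st) auto
        then have "v \<in> pverts T" using d.stack_opened d.opened_inner inner_sub by auto
        then show False using b I st verts by (simp add: dfs_memory_def searched_def)
      qed
      then show "?R s" using d.finished I ert by (simp add: dfs_memory_def)
    next
      show "?I ?m s'" using s' by (intro exI[of _ "[r]"] exI[of _ "{r}"] exI[of _ E]) simp
    qed simp
    moreover have "card inner \<le> n" using card_mono[OF _ inner_sub] verts by simp
    then have "?m \<le> 3 * n" using card_arcs by simp
    then have "?m * (cost dfs_body + 1) + 1 \<le> 3 * n * (cost dfs_body + 1) + 1"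
      by (intro add_right_mono mult_le_mono1)
    ultimately show ?thesis by (rule runs_mono) auto
  qed
  show ?thesis
  proof (rule runs_seq[OF runs_loop_free[where R = "\<lambda>s'. dfs_memory r s' [r] {r} E"] loop])
    have eff: "effect dfs_start s = s(15 := (s 15)(r := n), 18 := (s 18)(0 := 1), 16 := (s 16)(r := 1), 19 := (s 19)(0 := r))"
      using s by (simp add: dfs_start_def r_def counted_def fun_eq_iff)
    have "(s 16) n = 0" using s(3) by simp
    then show "dfs_memory r (effect dfs_start s) [r] {r} E"
      using s(1) rn dfs_init[of "(s 16)(r := 1)" "(s 15)(r := n)" "s 17"]
      by (simp add: eff dfs_memory_def searched_def counted_def)
  qed simp_all
qed

text \<open>
  The left end of the interval of \<open>v\<close> is always the number of its parent; only the right ends distinguish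
  leaves from inner vertices.
\<close>

lemma runs_output:
  assumes s: "searched s r" "s 3 0 = n" "s 7 0 = 0" "end_rooted_graph T r"
    "inner_rooted_tree.preorder_numbering (pverts T) E r (s 15) (s 16) (s 17) (s 18 0)"
  shows "runs (While more_verts output_body) s (n * (cost output_body + 1) + 1)
    (\<lambda>s. optimal_overlap_rep T (output_sets s))"
proof -
  interpret end_rooted_graph T r by fact
  define f where "f = interval_rep (s 15) (s 16) (s 17)"
  have f: "{s 16 (s 15 v)..(if Suc 0 < s 9 v then s 16 v else s 17 (s 15 v))} = f v" for v
    using s(1) degree_inner[of "s 9" v] by (auto simp: searched_def f_def interval_rep_def)
  let ?I = "\<lambda>m s'. \<exists>i\<le>n. m = n - i \<and> s' 7 0 = i \<and> s' 0 0 = n \<and> s' 3 0 = n \<and> (\<forall>a\<ge>9. s' a = s a) \<and>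
     (\<forall>j<i. s' 4 j = j \<and> {s' 5 j..s' 6 j} = f j)"
  show ?thesis
  proof (rule runs_while[where I = ?I])
    fix m s' assume "?I m s'" and b: "bval more_verts s'"
    then obtain i where i: "i \<le> n" "m = n - i" "s' 7 0 = i" "s' 0 0 = n" "s' 3 0 = n" "\<forall>a\<ge>9. s' a = s a"
      "\<forall>j<i. s' 4 j = j \<and> {s' 5 j..s' 6 j} = f j" by blast
    have il: "i < n" using b i by (simp add: more_verts_def)
    have eff: "effect output_body s' = s'(4 := (s' 4)(i := i), 5 := (s' 5)(i := s 16 (s 15 i)),
        6 := (s' 6)(i := (if Suc 0 < s 9 i then s 16 i else s 17 (s 15 i))), 7 := (s' 7)(0 := Suc i))"
      using i by (simp add: output_body_def fun_eq_iff)
    have "\<forall>j<Suc i. effect output_body s' 4 j = j \<and> {effect output_body s' 5 j..effect output_body s' 6 j} = f j"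
      using i(7) f[of i] by (simp add: eff less_Suc_eq)
    moreover have "effect output_body s' 7 0 = Suc i \<and> effect output_body s' 0 0 = n \<and> effect output_body s' 3 0 = n
        \<and> (\<forall>a\<ge>9. effect output_body s' a = s a)" using i by (simp add: eff)
    ultimately show "\<exists>m'<m. ?I m' (effect output_body s')"
      using il i by (intro exI[of _ "n - Suc i"] conjI exI[of _ "Suc i"]) auto
  next
    fix m s' assume "?I m s'" and b: "\<not> bval more_verts s'"
    then obtain i where i: "i \<le> n" "s' 7 0 = i" "s' 0 0 = n" "s' 3 0 = n"
      "\<forall>j<i. s' 4 j = j \<and> {s' 5 j..s' 6 j} = f j" by blast
    have "i = n" using b i by (simp add: more_verts_def)
    have "output_sets s' v = interval_rep (s 15) (s 16) (s 17) v" if "v \<in> pverts T" for v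
    proof -
      have "{j. j < s' 3 0 \<and> s' 4 j = v} = {v}" using i \<open>i = n\<close> that verts by auto
      then show ?thesis using i \<open>i = n\<close> that verts by (simp add: output_sets_def f_def)
    qed
    then show "optimal_overlap_rep T (output_sets s')" using optimal_interval_rep(1)[OF s(5)] by blast
  next
    show "?I n s" using s by (intro exI[of _ 0]) (auto simp: searched_def)
  qed simp
qed

lemma runs_program: "runs program s0 (time_bound * n) (\<lambda>s. optimal_overlap_rep T (output_sets s))"
proof -
  let ?zero = "\<lambda>s k. \<forall>a\<ge>k. s a = (\<lambda>_. 0)"
  let ?start = "\<lambda>s. s 0 0 = n \<and> s 1 = s0 1 \<and> s 2 = s0 2 \<and>
      (\<forall>a. 7 \<le> a \<longrightarrow> a \<noteq> 8 \<longrightarrow> s a = (\<lambda>_. 0)) \<and> s 8 0 = 1"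
  let ?built = "\<lambda>s. built s (length es) \<and> ?zero s 13"
  let ?counted = "\<lambda>s. counted s \<and> degrees (s 13) (E \<inter> nonleaf_arcs) \<and> ?zero s 14"
  let ?rooted = "\<lambda>s. counted s \<and> good_root (s 14 0) \<and> ?zero s 15"
  let ?num = "\<lambda>s r. end_rooted_graph T r \<and>
       inner_rooted_tree.preorder_numbering (pverts T) E r (s 15) (s 16) (s 17) (s 18 0)"
  let ?numbered = "\<lambda>s. \<exists>r. searched s r \<and> ?num s r"
  let ?optimal = "\<lambda>s. optimal_overlap_rep T (output_sets s)"
  have 0: "runs (put 8 (Const 1)) s0 (cost (put 8 (Const 1))) ?start"
    by (rule runs_loop_free) (auto simp: input_memory_def fun_eq_iff)
  have 1: "runs (While more_edges build_body) s (n * (cost build_body + 1) + 1) ?built" if "?start s" for s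
    using that by (intro runs_build) auto
  have 2: "runs (put 7 (Const 0)) s (cost (put 7 (Const 0))) (\<lambda>s. ?built s \<and> s 7 0 = 0)" if "?built s" for s
    by (rule runs_loop_free) (use that in \<open>auto simp: built_def\<close>)
  have 3: "runs (While more_edges count_body) s (n * (cost count_body + 1) + 1) ?counted"
    if "?built s \<and> s 7 0 = 0" for s
    using that by (intro runs_count) auto
  have 4: "runs (put 7 (Const 0)) s (cost (put 7 (Const 0))) (\<lambda>s. ?counted s \<and> s 7 0 = 0)" if "?counted s" for s
    by (rule runs_loop_free) (use that in \<open>auto simp: counted_def\<close>)
  have 5: "runs (While more_verts root_body) s (n * (cost root_body + 1) + 1) ?rooted"
    if "?counted s \<and> s 7 0 = 0" for s
    using that by (intro runs_root) auto
  have 6: "runs dfs s (cost dfs_start + (3 * n * (cost dfs_body + 1) + 1)) ?numbered" if "?rooted s" for s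
  proof -
    have "counted s" "good_root (s 14 0)" "?zero s 15" using that by auto
    from runs_dfs[OF this] show ?thesis unfolding dfs_def by (rule runs_mono) auto
  qed
  have 7: "runs (Seq (put 3 (var 0)) (put 7 (Const 0))) s (cost (Seq (put 3 (var 0)) (put 7 (Const 0))))
      (\<lambda>s. ?numbered s \<and> s 3 0 = n \<and> s 7 0 = 0)" if "?numbered s" for s
    by (rule runs_loop_free) (use that in \<open>auto simp: searched_def\<close>)
  have 8: "runs (While more_verts output_body) s (n * (cost output_body + 1) + 1) ?optimal"
    if "?numbered s \<and> s 3 0 = n \<and> s 7 0 = 0" for s
    using that runs_output by blast
  have n1: "1 \<le> n" using n3 by simp
  let ?t = "cost (put 8 (Const 1)) + (n * (cost build_body + 1) + 1 + (cost (put 7 (Const 0)) +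
      (n * (cost count_body + 1) + 1 + (cost (put 7 (Const 0)) + (n * (cost root_body + 1) + 1 +
      (cost dfs_start + (3 * n * (cost dfs_body + 1) + 1) + (cost (Seq (put 3 (var 0)) (put 7 (Const 0))) +
      (n * (cost output_body + 1) + 1))))))))"
  have "runs program s0 ?t ?optimal" unfolding program_def
    by (rule runs_seq[OF 0 runs_seq[OF 1 runs_seq[OF 2 runs_seq[OF 3 runs_seq[OF 4 runs_seq[OF 5
          runs_seq[OF 6 runs_seq[OF 7 8]]]]]]]])
  moreover have "(cost dfs_start + 10) * 1 \<le> (cost dfs_start + 10) * n"
    using n1 by (intro mult_le_mono2)
  then have "?t \<le> time_bound * n" by (simp add: time_bound_def algebra_simps)
  ultimately show ?thesis by (rule runs_mono) simp
qed

end

section \<open>The overlap number of a tree\<close>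

theorem theorem2p13:
  shows "(\<forall>T :: 'a pair_pre_digraph. undirected_tree T \<and> 3 \<le> card (pverts T) \<longrightarrow>
            (\<exists>S. skeleton_of S T) \<and>
            (\<forall>S. skeleton_of S T \<longrightarrow> overlap_number T = card (pverts S)))
       \<and> (\<exists>P c. \<forall>(T :: nat pair_pre_digraph) n es.
            undirected_tree T \<and> 3 \<le> n \<and> pverts T = {..<n} \<and> edge_list T es \<longrightarrow>
            (\<exists>t s. exec P (input_memory n es) t s \<and> t \<le> c * n \<and>
                   optimal_overlap_rep T (output_sets s)))"
proof (intro conjI allI impI)
  fix T :: "'a pair_pre_digraph"
  assume T: "undirected_tree T \<and> 3 \<le> card (pverts T)"
  then show "\<exists>S. skeleton_of S T" using skeleton_of_exists by blast
  obtain r where "end_rooted_graph T r" using end_rooted_graph_exists T by blast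
  then interpret end_rooted_graph T r .
  show "overlap_number T = card (pverts S)" if "skeleton_of S T" for S
    using overlap_number_eq_skeleton that .
next
  have "\<exists>t s. exec program (input_memory n es) t s \<and> t \<le> time_bound * n \<and> optimal_overlap_rep T (output_sets s)"
    if "undirected_tree T \<and> 3 \<le> n \<and> pverts T = {..<n} \<and> edge_list T es" for T n es
  proof -
    interpret tree_input T n es by unfold_locales (use that in auto)
    show ?thesis using runs_program unfolding runs_def .
  qed
  then show "\<exists>P c. \<forall>(T :: nat pair_pre_digraph) n es.
            undirected_tree T \<and> 3 \<le> n \<and> pverts T = {..<n} \<and> edge_list T es \<longrightarrow>
            (\<exists>t s. exec P (input_memory n es) t s \<and> t \<le> c * n \<and>
                   optimal_overlap_rep T (output_sets s))" by blast
qed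

end
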